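(* Let $G=\{g_1=1,g_2,\ldots,g_k\}$ be a finite non-trivial step-2 nilpotent group in which $g^2$ is central for every $g\in G$. Then the automata group $\mathcal G(\mathcal C(G))$ generated by the Cayley machine of $G$ has the presentation with generators $x,g_2,\ldots,g_k$ and relations: the relations of the multiplication table of $G$ among $g_1=1,g_2,\ldots,g_k$, together with $$[x^m g_j x^{-m},\ x^n g_i x^{-n}]=x^{\lceil (n+m)/2\rceil}\,[g_j,g_i]\,x^{-\lceil (n+m)/2\rceil},\qquad m,n\in\mathbb Z,\ 2\le j,i\le k,$$ where on the right-hand side $[g_j,g_i]$ denotes the element of $G$ given by the commutator.
   Context: Commutators are $[g,h]=g^{-1}h^{-1}gh$, and $\lceil a\rceil$ is the least integer greater than or equal to $a$. "Step-2 nilpotent" means that all commutators of $G$ are central in $G$ (the abelian case is included). Cayley machine: for a non-trivial finite group $G$, the Cayley machine $\mathcal C(G)$ is the automaton with state set $G$ and alphabet $G$ which, in state $g_0$ on reading input letter $g$, moves to state $g_0g$ and outputs $g_0g$. Each state $g\in G$ defines a bijection $\mathcal C(G)_g$ of the set $G^\omega$ of right-infinite words over $G$, namely $\mathcal C(G)_g(a_0,a_1,a_2,\ldots)=(ga_0,\,ga_0a_1,\,ga_0a_1a_2,\ldots)$. The automata group $\mathcal G(\mathcal C(G))$ is the group of bijections of $G^\omega$ generated by all $\mathcal C(G)_g$, $g\in G$, with product given by composition, $(\alpha\beta)(w)=\alpha(\beta(w))$. In the presentation, $x$ corresponds to $\mathcal C(G)_1^{-1}$ and $g\in G$ corresponds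 to $x\,\mathcal C(G)_g$, which is the map $(a_0,a_1,a_2,\ldots)\mapsto(ga_0,a_1,a_2,\ldots)$. *)

theory Defs
  imports Complex_Main "HOL-Algebra.Bij" "HOL-Algebra.Generated_Groups"
begin

section \<open>Commutators, centre, nilpotency class at most two\<close>

definition commutator :: "('a, 'b) monoid_scheme \<Rightarrow> 'a \<Rightarrow> 'a \<Rightarrow> 'a" where
  "commutator G g h = inv\<^bsub>G\<^esub> g \<otimes>\<^bsub>G\<^esub> inv\<^bsub>G\<^esub> h \<otimes>\<^bsub>G\<^esub> g \<otimes>\<^bsub>G\<^esub> h"

definition centre :: "('a, 'b) monoid_scheme \<Rightarrow> 'a set" where
  "centre G = {z \<in> carrier G. \<forall>g \<in> carrier G. z \<otimes>\<^bsub>G\<^esub> g = g \<otimes>\<^bsub>G\<^esub> z}"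

definition step2_nilpotent :: "('a, 'b) monoid_scheme \<Rightarrow> bool" where
  "step2_nilpotent G \<longleftrightarrow> (\<forall>g \<in> carrier G. \<forall>h \<in> carrier G. commutator G g h \<in> centre G)"


section \<open>Free groups and group presentations\<close>

text \<open>A word is a list of signed letters: \<open>(s, True)\<close> stands for the generator \<open>s\<close> and
  \<open>(s, False)\<close> for its formal inverse.\<close>

definition free_words :: "'s set \<Rightarrow> ('s \<times> bool) list set" where
  "free_words S = lists (S \<times> UNIV)"

inductive_set free_rel :: "'s set \<Rightarrow> (('s \<times> bool) list \<times> ('s \<times> bool) list) set"
  for S :: "'s set" where
  refl: "w \<in> free_words S \<Longrightarrow> (w, w) \<in> free_rel S"
| cancel: "\<lbrakk>u \<in> free_words S; v \<in> free_words S; s \<in> S\<rbrakk>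
    \<Longrightarrow> (u @ [(s, b), (s, \<not> b)] @ v, u @ v) \<in> free_rel S"
| sym: "(u, v) \<in> free_rel S \<Longrightarrow> (v, u) \<in> free_rel S"
| trans: "\<lbrakk>(u, v) \<in> free_rel S; (v, w) \<in> free_rel S\<rbrakk> \<Longrightarrow> (u, w) \<in> free_rel S"

definition free_group :: "'s set \<Rightarrow> ('s \<times> bool) list set monoid" where
  "free_group S =
    \<lparr>carrier = free_words S // free_rel S,
     mult = \<lambda>A B. \<Union>u\<in>A. \<Union>v\<in>B. free_rel S `` {u @ v},
     one = free_rel S `` {[]}\<rparr>"

definition free_gen :: "'s set \<Rightarrow> 's \<Rightarrow> ('s \<times> bool) list set" where
  "free_gen S s = free_rel S `` {[(s, True)]}"

definition normal_closure :: "('a, 'b) monoid_scheme \<Rightarrow> 'a set \<Rightarrow> 'a set" where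
  "normal_closure G R = \<Inter>{N. N \<lhd> G \<and> R \<subseteq> N}"

text \<open>The set \<open>E\<close> consists of pairs \<open>(l, r)\<close> of elements of the free group on \<open>S\<close>, read as
  relations \<open>l = r\<close>.\<close>

definition relators :: "'s set \<Rightarrow> (('s \<times> bool) list set \<times> ('s \<times> bool) list set) set
    \<Rightarrow> ('s \<times> bool) list set set" where
  "relators S E = {l \<otimes>\<^bsub>free_group S\<^esub> inv\<^bsub>free_group S\<^esub> r | l r. (l, r) \<in> E}"

definition presented_group :: "'s set \<Rightarrow> (('s \<times> bool) list set \<times> ('s \<times> bool) list set) set
    \<Rightarrow> ('s \<times> bool) list set set monoid" where
  "presented_group S E = free_group S Mod normal_closure (free_group S) (relators S E)"

definition presented_gen :: "'s set \<Rightarrow> (('s \<times> bool) list set \<times> ('s \<times> bool) list set) set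
    \<Rightarrow> 's \<Rightarrow> ('s \<times> bool) list set set" where
  "presented_gen S E s =
    normal_closure (free_group S) (relators S E) #>\<^bsub>free_group S\<^esub> free_gen S s"


section \<open>Mealy automata and automata groups\<close>

record ('q, 'a) mealy =
  states :: "'q set"
  alphabet :: "'a set"
  next_state :: "'q \<Rightarrow> 'a \<Rightarrow> 'q"
  out_letter :: "'q \<Rightarrow> 'a \<Rightarrow> 'a"

definition omega_words :: "'a set \<Rightarrow> (nat \<Rightarrow> 'a) set" where
  "omega_words A = UNIV \<rightarrow> A"

primrec state_at :: "('q, 'a) mealy \<Rightarrow> 'q \<Rightarrow> (nat \<Rightarrow> 'a) \<Rightarrow> nat \<Rightarrow> 'q" where
  "state_at M q w 0 = q"
| "state_at M q w (Suc n) = next_state M (state_at M q w n) (w n)"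

text \<open>The transformation of infinite words defined by the initial state \<open>q\<close>; it is restricted to
  the words over the alphabet because \<^const>\<open>BijGroup\<close> consists of extensional functions.\<close>

definition state_map :: "('q, 'a) mealy \<Rightarrow> 'q \<Rightarrow> (nat \<Rightarrow> 'a) \<Rightarrow> (nat \<Rightarrow> 'a)" where
  "state_map M q = (\<lambda>w \<in> omega_words (alphabet M). \<lambda>n. out_letter M (state_at M q w n) (w n))"

text \<open>Only meaningful if every state defines a bijection. The product in \<^const>\<open>BijGroup\<close> is
  composition with the right factor applied first.\<close>

definition automata_group :: "('q, 'a) mealy \<Rightarrow> ((nat \<Rightarrow> 'a) \<Rightarrow> (nat \<Rightarrow> 'a)) monoid" where
  "automata_group M =
    (BijGroup (omega_words (alphabet M)))
      \<lparr>carrier := generate (BijGroup (omega_words (alphabet M))) (state_map M ` states M)\<rparr>"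

definition cayley_machine :: "('a, 'b) monoid_scheme \<Rightarrow> ('a, 'a) mealy" where
  "cayley_machine G =
    \<lparr>states = carrier G, alphabet = carrier G,
     next_state = (\<lambda>g\<^sub>0 g. g\<^sub>0 \<otimes>\<^bsub>G\<^esub> g), out_letter = (\<lambda>g\<^sub>0 g. g\<^sub>0 \<otimes>\<^bsub>G\<^esub> g)\<rparr>"


section \<open>The presentation attached to a finite group\<close>

text \<open>The generators are \<open>x\<close> and one letter for each non-identity element of \<open>G\<close>.\<close>

datatype 'a cayley_sym = Sym_x | Sym_elt 'a

definition cayley_gens :: "('a, 'b) monoid_scheme \<Rightarrow> 'a cayley_sym set" where
  "cayley_gens G = insert Sym_x (Sym_elt ` (carrier G - {\<one>\<^bsub>G\<^esub>}))"

abbreviation cayley_free :: "('a, 'b) monoid_scheme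
    \<Rightarrow> ('a cayley_sym \<times> bool) list set monoid" where
  "cayley_free G \<equiv> free_group (cayley_gens G)"

definition sym_x :: "('a, 'b) monoid_scheme \<Rightarrow> ('a cayley_sym \<times> bool) list set" where
  "sym_x G = free_gen (cayley_gens G) Sym_x"

definition sym_elt :: "('a, 'b) monoid_scheme \<Rightarrow> 'a \<Rightarrow> ('a cayley_sym \<times> bool) list set" where
  "sym_elt G g =
    (if g = \<one>\<^bsub>G\<^esub> then \<one>\<^bsub>cayley_free G\<^esub> else free_gen (cayley_gens G) (Sym_elt g))"

text \<open>The element \<open>x\<^sup>m a x\<^sup>-\<^sup>m\<close> of the free group.\<close>

definition x_conj :: "('a, 'b) monoid_scheme \<Rightarrow> int \<Rightarrow> ('a cayley_sym \<times> bool) list set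
    \<Rightarrow> ('a cayley_sym \<times> bool) list set" where
  "x_conj G m a = sym_x G [^]\<^bsub>cayley_free G\<^esub> m \<otimes>\<^bsub>cayley_free G\<^esub> a
     \<otimes>\<^bsub>cayley_free G\<^esub> sym_x G [^]\<^bsub>cayley_free G\<^esub> (- m)"

definition table_relations :: "('a, 'b) monoid_scheme
    \<Rightarrow> (('a cayley_sym \<times> bool) list set \<times> ('a cayley_sym \<times> bool) list set) set" where
  "table_relations G =
    {(sym_elt G g \<otimes>\<^bsub>cayley_free G\<^esub> sym_elt G h, sym_elt G (g \<otimes>\<^bsub>G\<^esub> h)) | g h.
       g \<in> carrier G \<and> h \<in> carrier G}"

definition commutator_relations :: "('a, 'b) monoid_scheme
    \<Rightarrow> (('a cayley_sym \<times> bool) list set \<times> ('a cayley_sym \<times> bool) list set) set" where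
  "commutator_relations G =
    {(commutator (cayley_free G) (x_conj G m (sym_elt G g)) (x_conj G n (sym_elt G h)),
      x_conj G \<lceil>real_of_int (n + m) / 2\<rceil> (sym_elt G (commutator G g h))) | m n g h.
       g \<in> carrier G - {\<one>\<^bsub>G\<^esub>} \<and> h \<in> carrier G - {\<one>\<^bsub>G\<^esub>}}"

abbreviation cayley_relations :: "('a, 'b) monoid_scheme
    \<Rightarrow> (('a cayley_sym \<times> bool) list set \<times> ('a cayley_sym \<times> bool) list set) set" where
  "cayley_relations G \<equiv> table_relations G \<union> commutator_relations G"


section \<open>Well-definedness\<close>

lemma free_words_simps [simp]:
  "[] \<in> free_words S"
  "(s, b) # w \<in> free_words S \<longleftrightarrow> s \<in> S \<and> w \<in> free_words S"
  "u @ v \<in> free_words S \<longleftrightarrow> u \<in> free_words S \<and> v \<in> free_words S"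
  by (auto simp: free_words_def)

lemma free_rel_words:
  "(u, v) \<in> free_rel S \<Longrightarrow> u \<in> free_words S \<and> v \<in> free_words S"
  by (induction rule: free_rel.induct) auto

lemma equiv_free_rel: "equiv (free_words S) (free_rel S)"
proof (rule equivI)
  show "free_rel S \<subseteq> free_words S \<times> free_words S" using free_rel_words by fast
  show "refl_on (free_words S) (free_rel S)" by (simp add: refl_on_def free_rel.refl)
  show "sym (free_rel S)" by (rule symI) (rule free_rel.sym)
  show "trans (free_rel S)" by (rule transI) (rule free_rel.trans)
qed

lemma free_rel_append_left:
  assumes "(u, v) \<in> free_rel S" "w \<in> free_words S"
  shows "(w @ u, w @ v) \<in> free_rel S"
  using assms
proof (induction rule: free_rel.induct)
  case (cancel u v s b)
  then show ?case using free_rel.cancel[of "w @ u" S v s b] by simp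
next
  case (trans u v v')
  then show ?case using free_rel.trans by blast
qed (auto intro: free_rel.refl free_rel.sym)

lemma free_rel_append_right:
  assumes "(u, v) \<in> free_rel S" "w \<in> free_words S"
  shows "(u @ w, v @ w) \<in> free_rel S"
  using assms
proof (induction rule: free_rel.induct)
  case (cancel u v s b)
  then show ?case using free_rel.cancel[of u S "v @ w" s b] by simp
next
  case (trans u v v')
  then show ?case using free_rel.trans by blast
qed (auto intro: free_rel.refl free_rel.sym)

lemma free_rel_append:
  assumes "(u, u') \<in> free_rel S" "(v, v') \<in> free_rel S"
  shows "(u @ v, u' @ v') \<in> free_rel S"
  using assms by (meson free_rel.trans free_rel_append_left free_rel_append_right free_rel_words)

lemma free_mult_class:
  assumes "u \<in> free_words S" "v \<in> free_words S"
  shows "free_rel S `` {u} \<otimes>\<^bsub>free_group S\<^esub> free_rel S `` {v} = free_rel S `` {u @ v}"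
proof -
  have "(\<lambda>u v. free_rel S `` {u @ v}) respects2 (free_rel S)"
    by (rule congruent2I')
      (rule equiv_class_eq[OF equiv_free_rel free_rel_append])
  from UN_equiv_class2[OF equiv_free_rel equiv_free_rel this assms]
  show ?thesis by (simp add: free_group_def)
qed

lemma free_carrierE:
  assumes "A \<in> carrier (free_group S)"
  obtains u where "u \<in> free_words S" "A = free_rel S `` {u}"
  using assms by (auto simp: free_group_def elim: quotientE)

lemma free_class_closed:
  "u \<in> free_words S \<Longrightarrow> free_rel S `` {u} \<in> carrier (free_group S)"
  by (simp add: free_group_def quotientI)

lemma free_one: "\<one>\<^bsub>free_group S\<^esub> = free_rel S `` {[]}"
  by (simp add: free_group_def)

lemma free_left_inverse:
  "u \<in> free_words S \<Longrightarrow> \<exists>v \<in> free_words S. (v @ u, []) \<in> free_rel S"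
proof (induction u)
  case Nil
  then show ?case by (auto intro!: bexI[of _ "[]"] free_rel.refl)
next
  case (Cons a u)
  obtain s b where a: "a = (s, b)" by (cases a)
  with Cons obtain v where v: "v \<in> free_words S" "(v @ u, []) \<in> free_rel S"
    and s: "s \<in> S" and u: "u \<in> free_words S" by auto
  have "((v @ [(s, \<not> b)]) @ a # u, v @ u) \<in> free_rel S"
    using free_rel.cancel[of v S u s "\<not> b"] v s u a by simp
  then have "((v @ [(s, \<not> b)]) @ a # u, []) \<in> free_rel S"
    using v(2) free_rel.trans by blast
  then show ?case using v s by (intro bexI[of _ "v @ [(s, \<not> b)]"]) auto
qed

lemma group_free_group: "group (free_group S)"
proof (rule groupI)
  fix A assume "A \<in> carrier (free_group S)"
  then obtain u where u: "u \<in> free_words S" "A = free_rel S `` {u}" by (rule free_carrierE)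
  obtain v where v: "v \<in> free_words S" "(v @ u, []) \<in> free_rel S"
    using free_left_inverse[OF u(1)] by blast
  then show "\<exists>B \<in> carrier (free_group S). B \<otimes>\<^bsub>free_group S\<^esub> A = \<one>\<^bsub>free_group S\<^esub>"
    using u equiv_class_eq[OF equiv_free_rel v(2)]
    by (intro bexI[of _ "free_rel S `` {v}"]) (simp_all add: free_mult_class free_class_closed free_one)
qed (auto elim!: free_carrierE simp: free_mult_class free_class_closed free_one)

lemma free_gen_closed: "s \<in> S \<Longrightarrow> free_gen S s \<in> carrier (free_group S)"
  by (simp add: free_gen_def free_class_closed)

lemma normal_normal_closure:
  assumes "group G" "R \<subseteq> carrier G"
  shows "normal_closure G R \<lhd> G"
proof -
  interpret group G by fact
  have ne: "carrier G \<in> {N. N \<lhd> G \<and> R \<subseteq> N}"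
    using assms(2) by (auto simp: normal_inv_iff subgroup_self)
  have "subgroup (normal_closure G R) G"
    unfolding normal_closure_def
    by (rule subgroups_Inter) (use ne in \<open>auto simp: normal_inv_iff\<close>)
  then show ?thesis
    unfolding normal_inv_iff by (auto simp: normal_closure_def normal_inv_iff)
qed

lemma state_map_cayley:
  assumes "w \<in> omega_words (carrier G)"
  shows "state_map (cayley_machine G) g w 0 = g \<otimes>\<^bsub>G\<^esub> w 0"
    and "state_map (cayley_machine G) g w (Suc n)
      = state_map (cayley_machine G) g w n \<otimes>\<^bsub>G\<^esub> w (Suc n)"
  using assms by (simp_all add: state_map_def cayley_machine_def)

lemma state_map_cayley_Bij:
  assumes "group G" and g: "g \<in> carrier G"
  shows "state_map (cayley_machine G) g \<in> Bij (omega_words (carrier G))"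
proof -
  interpret group G by fact
  let ?W = "omega_words (carrier G)" and ?f = "state_map (cayley_machine G) g"
  let ?h = "\<lambda>b n. case n of 0 \<Rightarrow> inv\<^bsub>G\<^esub> g \<otimes>\<^bsub>G\<^esub> b 0 | Suc k \<Rightarrow> inv\<^bsub>G\<^esub> (b k) \<otimes>\<^bsub>G\<^esub> b (Suc k)"
  have fc: "?f w n \<in> carrier G" if "w \<in> ?W" for w n
    using that g by (induction n) (auto simp: state_map_cayley, auto simp: omega_words_def)
  have hW: "?h b \<in> ?W" if "b \<in> ?W" for b
    using that g by (auto simp: omega_words_def Pi_def split: nat.split)
  have "bij_betw ?f ?W ?W"
  proof (rule bij_betw_byWitness[where f' = ?h])
    show "\<forall>w \<in> ?W. ?h (?f w) = w"
    proof (intro ballI ext)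
      fix w n assume w: "w \<in> ?W"
      then have "w k \<in> carrier G" for k by (auto simp: omega_words_def)
      then show "?h (?f w) n = w n"
        using g fc[OF w] by (cases n) (simp_all add: state_map_cayley[OF w] m_assoc[symmetric])
    qed
    show "\<forall>b \<in> ?W. ?f (?h b) = b"
    proof (intro ballI ext)
      fix b n assume b: "b \<in> ?W"
      then have bc: "b k \<in> carrier G" for k by (auto simp: omega_words_def)
      show "?f (?h b) n = b n"
        using g bc
        by (induction n) (simp_all add: state_map_cayley[OF hW[OF b]] m_assoc[symmetric])
    qed
    show "?f ` ?W \<subseteq> ?W" using fc by (auto simp: omega_words_def)
    show "?h ` ?W \<subseteq> ?W" using hW by blast
  qed
  then show ?thesis
    by (auto simp: Bij_def state_map_def cayley_machine_def)
qed

end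

theory Submission
  imports Defs
begin

text \<open>Let \<open>T\<^sub>g\<close> multiply the first letter of a word by \<open>g\<close>, and let \<open>X\<close> be the inverse of the
  transformation of the identity state. On a word with first letter \<open>a\<close>, the map \<open>X\<close> acts on the tail
  as \<open>T\<^sub>b X\<close> with \<open>b = a\<inverse>\<close>; hence \<open>X\<^sup>n T\<^sub>h X\<^sup>-\<^sup>n\<close> acts on the tail as a product of the conjugates
  \<open>X\<^sup>i T\<^sub>g X\<^sup>-\<^sup>i\<close> with \<open>0 \<le> i < n\<close>. Rearranging this product by the commutator relations between
  exponents of smaller distance yields the relations for distance \<open>n\<close>, so all relations hold in the
  automata group by induction.

  Conversely, the relations bring every element of the presented group to the form
  \<open>x\<^sup>d g\<^sub>0 (x g\<^sub>1 x\<^sup>-\<^sup>1) \<dots> (x\<^sup>m g\<^sub>m x\<^sup>-\<^sup>m) x\<^sup>j\<close>. The image of the middle part changes only finitely many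
  letters, and the last one it changes sits at the largest \<open>i\<close> with \<open>g\<^sub>i \<noteq> 1\<close>, whereas no non-zero
  power of \<open>X\<close> changes only a bounded set of letters. Hence the kernel is trivial.\<close>

section \<open>Commutators in groups of class two with central squares\<close>

locale central_squares_group = group G for G (structure) +
  assumes commutator_centre: "\<lbrakk>g \<in> carrier G; h \<in> carrier G\<rbrakk> \<Longrightarrow> commutator G g h \<in> centre G"
    and square_centre: "g \<in> carrier G \<Longrightarrow> g [^] (2::nat) \<in> centre G"

lemma (in group) commutator_closed [simp, intro]:
  "\<lbrakk>g \<in> carrier G; h \<in> carrier G\<rbrakk> \<Longrightarrow> commutator G g h \<in> carrier G"
  by (simp add: commutator_def)

text \<open>Commutator identities are used below as swap rules \<open>p q = q p r\<close>, which
  avoid inverses.\<close>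

lemma (in group) commutator_eq_iff:
  assumes "p \<in> carrier G" "q \<in> carrier G" "r \<in> carrier G"
  shows "commutator G p q = r \<longleftrightarrow> p \<otimes> q = q \<otimes> p \<otimes> r"
proof
  assume "commutator G p q = r"
  then have "r = inv p \<otimes> inv q \<otimes> p \<otimes> q" by (simp add: commutator_def)
  then have "r = inv (q \<otimes> p) \<otimes> (p \<otimes> q)" using assms by (simp add: inv_mult_group m_assoc)
  then show "p \<otimes> q = q \<otimes> p \<otimes> r" using assms by (metis inv_solve_left m_closed)
next
  assume e: "p \<otimes> q = q \<otimes> p \<otimes> r"
  have "commutator G p q = inv p \<otimes> (inv q \<otimes> (p \<otimes> q))"
    using assms by (simp add: commutator_def m_assoc)
  also have "\<dots> = r" unfolding e using assms by (simp add: m_assoc inv_solve_left')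
  finally show "commutator G p q = r" .
qed

lemma (in group) centre_commute:
  "\<lbrakk>z \<in> centre G; g \<in> carrier G\<rbrakk> \<Longrightarrow> z \<otimes> g = g \<otimes> z"
  by (simp add: centre_def)

lemma (in group) centre_closed: "z \<in> centre G \<Longrightarrow> z \<in> carrier G"
  by (simp add: centre_def)

lemma (in group) commutator_swap:
  assumes "p \<in> carrier G" "q \<in> carrier G"
  shows "p \<otimes> q = q \<otimes> p \<otimes> commutator G p q"
  using commutator_eq_iff assms by blast

lemma (in group) commutator_centre_left:
  assumes "z \<in> centre G" "g \<in> carrier G"
  shows "commutator G z g = \<one>"
  using assms by (simp add: commutator_eq_iff centre_commute centre_closed)

lemma (in group) commutator_centre_right:
  assumes "z \<in> centre G" "g \<in> carrier G"
  shows "commutator G g z = \<one>"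
  using assms by (simp add: commutator_eq_iff centre_commute centre_closed)

context central_squares_group
begin

text \<open>Move c to the left through b and then through a; the central factor [a, c] created on
  the way passes b freely.\<close>

lemma commutator_mult_left:
  assumes [simp]: "a \<in> carrier G" "b \<in> carrier G" "c \<in> carrier G"
  shows "commutator G (a \<otimes> b) c = commutator G a c \<otimes> commutator G b c"
proof -
  let ?p = "commutator G a c" and ?q = "commutator G b c"
  have pb: "?p \<otimes> b = b \<otimes> ?p" by (simp add: centre_commute commutator_centre)
  have "a \<otimes> b \<otimes> c = a \<otimes> (b \<otimes> c)" by (simp add: m_assoc)
  also have "\<dots> = (a \<otimes> c) \<otimes> (b \<otimes> ?q)"
    by (subst commutator_swap[of b c]) (simp_all add: m_assoc)
  also have "\<dots> = c \<otimes> a \<otimes> (?p \<otimes> b) \<otimes> ?q"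
    by (subst commutator_swap[of a c]) (simp_all add: m_assoc)
  also have "\<dots> = c \<otimes> (a \<otimes> b) \<otimes> (?p \<otimes> ?q)" unfolding pb by (simp add: m_assoc)
  finally show ?thesis by (simp add: commutator_eq_iff)
qed

text \<open>By linearity the square is [a a, b], and a a is central.\<close>

lemma commutator_square:
  assumes [simp]: "a \<in> carrier G" "b \<in> carrier G"
  shows "commutator G a b \<otimes> commutator G a b = \<one>"
proof -
  have "commutator G a b \<otimes> commutator G a b = commutator G (a \<otimes> a) b"
    by (simp add: commutator_mult_left)
  also have "a \<otimes> a = a [^] (2::nat)" by (simp add: numeral_2_eq_2)
  also have "commutator G (a [^] (2::nat)) b = \<one>"
    by (simp add: commutator_centre_left square_centre)
  finally show ?thesis .
qed

text \<open>Exchanging the arguments inverts a commutator, and here every commutator is its own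
  inverse.\<close>

lemma commutator_sym:
  assumes [simp]: "a \<in> carrier G" "b \<in> carrier G"
  shows "commutator G b a = commutator G a b"
proof -
  have "b \<otimes> a = b \<otimes> a \<otimes> commutator G a b \<otimes> commutator G a b"
    by (simp add: commutator_square m_assoc)
  also have "\<dots> = a \<otimes> b \<otimes> commutator G a b"
    using commutator_swap[of a b] by simp
  finally show ?thesis by (simp add: commutator_eq_iff)
qed

lemma commutator_inv_left:
  assumes [simp]: "a \<in> carrier G" "b \<in> carrier G"
  shows "commutator G (inv a) b = commutator G a b"
proof -
  have "commutator G (inv a) b \<otimes> commutator G a b = \<one>"
    by (simp add: commutator_mult_left[symmetric] commutator_centre_left centre_def)
  then show ?thesis by (metis assms commutator_closed commutator_square inv_closed right_cancel)
qed

lemma commutator_inv_inv: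
  "\<lbrakk>a \<in> carrier G; b \<in> carrier G\<rbrakk> \<Longrightarrow> commutator G (inv a) (inv b) = commutator G a b"
  by (metis commutator_inv_left commutator_sym inv_closed)

end

section \<open>Conjugates by powers of a fixed element\<close>

definition cpow :: "('c, 'd) monoid_scheme \<Rightarrow> ('a \<Rightarrow> 'c) \<Rightarrow> 'c \<Rightarrow> int \<Rightarrow> 'a \<Rightarrow> 'c" where
  "cpow A t x i g = x [^]\<^bsub>A\<^esub> i \<otimes>\<^bsub>A\<^esub> t g \<otimes>\<^bsub>A\<^esub> x [^]\<^bsub>A\<^esub> (- i)"

primrec oprod :: "('c, 'd) monoid_scheme \<Rightarrow> ('a \<Rightarrow> 'c) \<Rightarrow> 'c \<Rightarrow> nat \<Rightarrow> (nat \<Rightarrow> 'a) \<Rightarrow> 'c" where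
  "oprod A t x 0 f = \<one>\<^bsub>A\<^esub>"
| "oprod A t x (Suc n) f = oprod A t x n f \<otimes>\<^bsub>A\<^esub> cpow A t x (int n) (f n)"

lemma oprod_cong: "(\<And>i. i < n \<Longrightarrow> f i = g i) \<Longrightarrow> oprod A t x n f = oprod A t x n g"
  by (induction n) auto

lemma cpow_hom:
  assumes "group A" "group B" "\<phi> \<in> hom A B" "x \<in> carrier A" "t g \<in> carrier A"
  shows "\<phi> (cpow A t x i g) = cpow B (\<phi> \<circ> t) (\<phi> x) i g"
proof -
  interpret group_hom A B \<phi> using assms by (simp add: group_hom_def group_hom_axioms_def)
  show ?thesis using assms by (simp add: cpow_def hom_int_pow)
qed

text \<open>This calculus is used twice: for the bijections of infinite words, where the relations
  have to be proved, and for the presented group, where they hold by definition and give normal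
  forms.\<close>

locale conjugates = A: group A + central_squares_group G
  for A (structure) and G :: "('a, 'b) monoid_scheme" +
  fixes t :: "'a \<Rightarrow> 'c" and x :: 'c
  assumes t_hom: "t \<in> hom G A" and x_closed [simp]: "x \<in> carrier A"
begin

abbreviation "cj \<equiv> cpow A t x"
abbreviation "op \<equiv> oprod A t x"
abbreviation "comm \<equiv> commutator G"
abbreviation "yy n a \<equiv> op n (\<lambda>_. a)"

lemma t_closed [simp]: "g \<in> carrier G \<Longrightarrow> t g \<in> carrier A"
  using t_hom by (auto simp: hom_def)

lemma cj_closed [simp]: "g \<in> carrier G \<Longrightarrow> cj i g \<in> carrier A"
  by (simp add: cpow_def)

lemma t_one: "t \<one>\<^bsub>G\<^esub> = \<one>"
  using t_hom A.group_axioms group_axioms by (simp add: hom_one)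

lemma cj_one [simp]: "cj i \<one>\<^bsub>G\<^esub> = \<one>"
  by (simp add: cpow_def t_one A.int_pow_mult[symmetric])

lemma cj_zero: "g \<in> carrier G \<Longrightarrow> cj 0 g = t g"
  by (simp add: cpow_def)

lemma pow_cancel [simp]:
  "x [^] (i::int) \<otimes> x [^] (- i) = \<one>" "x [^] (- i) \<otimes> x [^] (i::int) = \<one>"
  by (simp_all add: A.int_pow_mult[symmetric])

lemma conj_mult:
  assumes [simp]: "a \<in> carrier A" "b \<in> carrier A"
  shows "x [^] (i::int) \<otimes> (a \<otimes> b) \<otimes> x [^] (-i)
    = (x [^] i \<otimes> a \<otimes> x [^] (-i)) \<otimes> (x [^] i \<otimes> b \<otimes> x [^] (-i))"
proof -
  have "(x [^] i \<otimes> a \<otimes> x [^] (-i)) \<otimes> (x [^] i \<otimes> b \<otimes> x [^] (-i))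
    = x [^] i \<otimes> a \<otimes> (x [^] (-i) \<otimes> x [^] i) \<otimes> b \<otimes> x [^] (-i)"
    by (simp only: A.m_assoc A.m_closed A.int_pow_closed x_closed assms)
  then show ?thesis by (simp add: A.m_assoc)
qed

lemma cj_mult:
  assumes "g \<in> carrier G" "h \<in> carrier G"
  shows "cj i (g \<otimes>\<^bsub>G\<^esub> h) = cj i g \<otimes> cj i h"
  using assms t_hom by (simp add: cpow_def hom_mult conj_mult)

lemma conj_cj:
  assumes "g \<in> carrier G"
  shows "x [^] (m::int) \<otimes> cj i g \<otimes> x [^] (- m) = cj (m + i) g"
proof -
  have "- (m + i) = - i + - m" by simp
  then show ?thesis
    using assms by (simp only: cpow_def A.int_pow_mult x_closed)
      (simp add: A.m_assoc)
qed

lemma op_closed [simp]: "(\<And>i. i < n \<Longrightarrow> f i \<in> carrier G) \<Longrightarrow> op n f \<in> carrier A"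
  by (induction n) auto

section \<open>Commutator relations between conjugates, sorted by the distance of exponents\<close>

lemma comm_square_cj:
  assumes "g \<in> carrier G" "h \<in> carrier G"
  shows "cj i (comm g h) \<otimes> cj i (comm g h) = \<one>"
  using assms by (simp add: cj_mult[symmetric] commutator_square)

text \<open>The defining relation for the exponents i and j as a swap rule;
  \<open>(i + j + 1) div 2\<close> is the ceiling of (i + j)/2.\<close>

definition rel :: "int \<Rightarrow> int \<Rightarrow> bool" where
  "rel i j \<longleftrightarrow> (\<forall>g \<in> carrier G. \<forall>h \<in> carrier G.
     cj i g \<otimes> cj j h = cj j h \<otimes> cj i g \<otimes> cj ((i + j + 1) div 2) (comm g h))"

lemma relD:
  "\<lbrakk>rel i j; g \<in> carrier G; h \<in> carrier G\<rbrakk>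
    \<Longrightarrow> cj i g \<otimes> cj j h = cj j h \<otimes> cj i g \<otimes> cj ((i + j + 1) div 2) (comm g h)"
  by (simp add: rel_def)

lemma rel_central:
  "\<lbrakk>rel i j; k \<in> centre G; h \<in> carrier G\<rbrakk> \<Longrightarrow> cj i k \<otimes> cj j h = cj j h \<otimes> cj i k"
  using relD[of i j k h] by (simp add: commutator_centre_left centre_closed)

text \<open>The correcting factor squares to one and is symmetric in g and h, so multiplying by it
  once more carries it to the other side.\<close>

lemma rel_sym:
  assumes "rel i j"
  shows "rel j i"
  unfolding rel_def
proof (intro ballI)
  fix h g assume gh [simp]: "h \<in> carrier G" "g \<in> carrier G"
  let ?z = "cj ((i + j + 1) div 2) (comm g h)"
  have "cj i g \<otimes> cj j h \<otimes> ?z = cj j h \<otimes> cj i g \<otimes> (?z \<otimes> ?z)"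
    by (simp add: relD[OF assms] A.m_assoc)
  then show "cj j h \<otimes> cj i g = cj i g \<otimes> cj j h \<otimes> cj ((j + i + 1) div 2) (comm h g)"
    by (simp add: comm_square_cj commutator_sym[of g h] add.commute)
qed

text \<open>Conjugation by x^m adds m to all exponents, and also to the rounded half-sum. Hence
  \<open>rel i j\<close> depends only on j - i.\<close>

lemma rel_shift:
  assumes "rel i j"
  shows "rel (m + i) (m + j)"
  unfolding rel_def
proof (intro ballI)
  fix g h assume gh [simp]: "g \<in> carrier G" "h \<in> carrier G"
  have "m + i + (m + j) + 1 = (i + j + 1) + m * 2" by simp
  then have d: "(m + i + (m + j) + 1) div 2 = m + (i + j + 1) div 2"
    by (simp only: div_mult_self1 zero_neq_numeral)
  have "x [^] m \<otimes> (cj i g \<otimes> cj j h) \<otimes> x [^] (-m)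
     = x [^] m \<otimes> (cj j h \<otimes> cj i g \<otimes> cj ((i + j + 1) div 2) (comm g h)) \<otimes> x [^] (-m)"
    by (simp add: relD[OF assms])
  then show "cj (m + i) g \<otimes> cj (m + j) h
    = cj (m + j) h \<otimes> cj (m + i) g \<otimes> cj ((m + i + (m + j) + 1) div 2) (comm g h)"
    unfolding d by (simp add: conj_mult conj_cj)
qed

text \<open>The induction hypothesis for proving the relations in the automata group.\<close>

definition rel_below :: "nat \<Rightarrow> bool" where
  "rel_below N \<longleftrightarrow> (\<forall>i j. \<bar>i - j\<bar> < int N \<longrightarrow> rel i j)"

text \<open>By shift invariance and symmetry the single pair (0, N) covers all pairs at distance
  N.\<close>

lemma rel_below_SucI:
  assumes "rel_below N" "rel 0 (int N)"
  shows "rel_below (Suc N)"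
  unfolding rel_below_def
proof (intro allI impI)
  fix i j :: int assume "\<bar>i - j\<bar> < int (Suc N)"
  then consider "\<bar>i - j\<bar> < int N" | "j = i + int N" | "i = j + int N" by linarith
  then show "rel i j"
  proof cases
    case 1 then show ?thesis using assms(1) by (simp add: rel_below_def)
  next
    case 2 then show ?thesis using rel_shift[OF assms(2), of i] by simp
  next
    case 3 then show ?thesis using rel_sym[OF rel_shift[OF assms(2), of j]] by simp
  qed
qed

section \<open>Ordered products with a constant letter and their multiplication rule\<close>

definition half :: "int \<Rightarrow> 'a \<Rightarrow> 'c" where
  "half s k = (if even s then cj (s div 2) k else \<one>)"

lemma half_closed [simp]: "k \<in> carrier G \<Longrightarrow> half s k \<in> carrier A"
  by (simp add: half_def)

lemma half_commute:
  assumes "rel (s div 2) j" "k \<in> centre G" "h \<in> carrier G"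
  shows "half s k \<otimes> cj j h = cj j h \<otimes> half s k"
  using rel_central[OF assms] assms by (simp add: half_def)

text \<open>This makes products of conjugates at exponents \<open>(s + 1) div 2\<close> telescope.
  For even s both factors sit at s/2 and cancel; for odd s the first is trivial and the second is
  the new boundary term.\<close>

lemma half_step:
  assumes "a \<in> carrier G" "h \<in> carrier G"
  shows "half s (comm a h) \<otimes> cj ((s + 1) div 2) (comm a h) = half (s + 1) (comm a h)"
  using assms by (auto simp: half_def comm_square_cj)

text \<open>In the product of the commutators [cj i a, cj n h] for i < m the exponents
  of neighbouring factors coincide in pairs, so that only the two boundary terms survive.\<close>

lemma yy_cj_swap:
  assumes N: "rel_below N" and n: "n < N" and [simp]: "a \<in> carrier G" "h \<in> carrier G"
  shows "m \<le> Suc n \<Longrightarrow> yy m a \<otimes> cj (int n) h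
    = cj (int n) h \<otimes> yy m a \<otimes> (half (int n) (comm a h) \<otimes> half (int (m + n)) (comm a h))"
proof (induction m)
  \<comment> \<open>For the empty product the two boundary terms coincide and cancel.\<close>
  case 0
  then show ?case by (auto simp: half_def comm_square_cj)
next
  case (Suc m)
  let ?k = "comm a h" and ?n = "int n" and ?m = "int m"
  \<comment> \<open>As m \<le> n, the exponents m, n, \<open>n div 2\<close> and
    \<open>(m + n) div 2\<close> all lie between 0 and n, so their distances are at most n < N and
    the induction hypothesis covers every swap.\<close>
  have kZ: "?k \<in> centre G" by (simp add: commutator_centre)
  have c1: "half ?n ?k \<otimes> cj ?m a = cj ?m a \<otimes> half ?n ?k"
    using N n Suc.prems kZ by (intro half_commute) (auto simp: rel_below_def)
  have c2: "half (?m + ?n) ?k \<otimes> cj ?m a = cj ?m a \<otimes> half (?m + ?n) ?k"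
    using N n Suc.prems kZ by (intro half_commute) (auto simp: rel_below_def)
  have r: "rel ?m ?n" using N n Suc.prems by (auto simp: rel_below_def)
  note IH = Suc.IH[OF Suc_leD[OF Suc.prems]]
  have s: "int (Suc m + n) = ?m + ?n + 1" "int (m + n) = ?m + ?n" by simp_all
  define z where "z = cj ((?m + ?n + 1) div 2) ?k"
  define u where "u = half ?n ?k"
  define v where "v = half (?m + ?n) ?k"
  define w where "w = half (?m + ?n + 1) ?k"
  define y where "y = yy m a"
  have [simp]: "z \<in> carrier A" "u \<in> carrier A" "v \<in> carrier A" "w \<in> carrier A" "y \<in> carrier A"
    by (simp_all add: z_def u_def v_def w_def y_def)
  \<comment> \<open>The commutator created by the new factor moves the upper boundary term one step
    on.\<close>
  have vz: "v \<otimes> z = w" by (simp add: v_def w_def z_def half_step)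
  have "yy (Suc m) a \<otimes> cj ?n h = y \<otimes> (cj ?m a \<otimes> cj ?n h)"
    by (simp add: A.m_assoc y_def)
  also have "\<dots> = y \<otimes> cj ?n h \<otimes> (cj ?m a \<otimes> z)"
    unfolding relD[OF r \<open>a \<in> carrier G\<close> \<open>h \<in> carrier G\<close>] z_def[symmetric] by (simp add: A.m_assoc)
  also have "y \<otimes> cj ?n h = cj ?n h \<otimes> y \<otimes> (u \<otimes> v)"
    using IH unfolding s by (simp only: u_def v_def y_def)
  also have "cj ?n h \<otimes> y \<otimes> (u \<otimes> v) \<otimes> (cj ?m a \<otimes> z) = cj ?n h \<otimes> (y \<otimes> (u \<otimes> (v \<otimes> cj ?m a \<otimes> z)))"
    by (simp add: A.m_assoc)
  also have "\<dots> = cj ?n h \<otimes> (y \<otimes> (u \<otimes> cj ?m a \<otimes> (v \<otimes> z)))"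
    unfolding c2[folded v_def] by (simp add: A.m_assoc)
  also have "\<dots> = cj ?n h \<otimes> (y \<otimes> cj ?m a) \<otimes> (u \<otimes> w)"
    unfolding c1[folded u_def] vz by (simp add: A.m_assoc)
  finally show ?case unfolding s by (simp add: u_def w_def y_def)
qed

lemma op_commute:
  assumes "z \<in> carrier A" "\<And>i. i < n \<Longrightarrow> f i \<in> carrier G"
    and "\<And>i. i < n \<Longrightarrow> z \<otimes> cj (int i) (f i) = cj (int i) (f i) \<otimes> z"
  shows "z \<otimes> op n f = op n f \<otimes> z"
  using assms
proof (induction n)
  case (Suc n)
  have "z \<otimes> op (Suc n) f = z \<otimes> op n f \<otimes> cj (int n) (f n)"
    using Suc.prems by (simp add: A.m_assoc)
  also have "\<dots> = op n f \<otimes> (z \<otimes> cj (int n) (f n))" using Suc by (simp add: A.m_assoc)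
  also have "\<dots> = op (Suc n) f \<otimes> z" using Suc.prems by (simp add: A.m_assoc)
  finally show ?case .
qed simp

text \<open>Induction on n: the new factor for \<open>a h\<close> splits into one for a and one for
  h, and the latter is moved left through the whole product for a by \<open>yy_cj_swap\<close>. The
  commutators left over telescope to at most one new factor.\<close>

lemma yy_mult:
  assumes N: "rel_below N" and [simp]: "a \<in> carrier G" "h \<in> carrier G"
  shows "n \<le> N \<Longrightarrow> yy n (a \<otimes>\<^bsub>G\<^esub> h) = yy n h \<otimes> (yy ((n + 1) div 2) (comm a h) \<otimes> yy n a)"
proof (induction n)
  case (Suc n)
  let ?k = "comm a h" and ?n = "int n" and ?r = "(n + 1) div 2"
  have kZ: "?k \<in> centre G" by (simp add: commutator_centre)
  have c1: "cj ?n h \<otimes> yy ?r ?k = yy ?r ?k \<otimes> cj ?n h"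
  proof (rule op_commute)
    fix i assume "i < ?r"
    then have "rel (int i) ?n" using N Suc.prems by (auto simp: rel_below_def)
    then show "cj ?n h \<otimes> cj (int i) ?k = cj (int i) ?k \<otimes> cj ?n h"
      by (simp add: rel_central kZ)
  qed auto
  have c2: "half ?n ?k \<otimes> yy (Suc n) a = yy (Suc n) a \<otimes> half ?n ?k"
    using N Suc.prems kZ by (intro op_commute half_commute) (auto simp: rel_below_def)
  \<comment> \<open>For even n the boundary term is the factor at exponent n/2 that comes next in
    the product for k; for odd n it is trivial and the length does not change.\<close>
  have e: "yy ?r ?k \<otimes> half ?n ?k = yy ((Suc n + 1) div 2) ?k"
    by (cases "even n") (auto simp: half_def elim!: evenE oddE)
  \<comment> \<open>The upper boundary sits at the odd number 2n + 1 and disappears.\<close>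
  have odd: "half (int (Suc n + n)) ?k = \<one>" by (simp add: half_def)
  have "yy (Suc n) (a \<otimes>\<^bsub>G\<^esub> h) = yy n h \<otimes> (yy ?r ?k \<otimes> (yy (Suc n) a \<otimes> cj ?n h))"
    using Suc by (simp add: cj_mult A.m_assoc)
  also have "yy (Suc n) a \<otimes> cj ?n h = cj ?n h \<otimes> (half ?n ?k \<otimes> yy (Suc n) a)"
    using yy_cj_swap[OF N, of n a h "Suc n"] Suc.prems odd
    by (simp only: c2) (simp add: A.m_assoc)
  also have "yy ?r ?k \<otimes> \<dots> = cj ?n h \<otimes> (yy ((Suc n + 1) div 2) ?k \<otimes> yy (Suc n) a)"
  proof -
    have "yy ?r ?k \<otimes> (cj ?n h \<otimes> (half ?n ?k \<otimes> yy (Suc n) a))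
        = (yy ?r ?k \<otimes> cj ?n h) \<otimes> (half ?n ?k \<otimes> yy (Suc n) a)"
      by (simp add: A.m_assoc)
    also have "\<dots> = cj ?n h \<otimes> ((yy ?r ?k \<otimes> half ?n ?k) \<otimes> yy (Suc n) a)"
      unfolding c1[symmetric] by (simp add: A.m_assoc)
    finally show ?thesis unfolding e .
  qed
  finally show ?case by (simp add: A.m_assoc)
qed simp

lemma op_one: "(\<And>i. i < n \<Longrightarrow> f i = \<one>\<^bsub>G\<^esub>) \<Longrightarrow> op n f = \<one>"
  by (induction n) auto

text \<open>Collecting all x on the right turns the successive letters into conjugates. Products
  with a constant letter arise in this way from the powers of \<open>T\<^sub>b X\<close> on
  tails.\<close>

lemma yy_pow:
  assumes [simp]: "a \<in> carrier G"
  shows "(t a \<otimes> x) [^] (n::nat) = yy n a \<otimes> x [^] n"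
proof (induction n)
  case (Suc n)
  have "cj (int n) a \<otimes> x [^] n = x [^] n \<otimes> t a"
    by (simp add: cpow_def int_pow_int[symmetric] A.m_assoc)
  then have "yy (Suc n) a \<otimes> x [^] Suc n = yy n a \<otimes> (x [^] n \<otimes> (t a \<otimes> x))"
    by (simp add: A.m_assoc) (simp add: A.m_assoc[symmetric])
  then show ?case by (simp add: Suc A.m_assoc)
qed simp

end

section \<open>Normal forms\<close>

context conjugates
begin

text \<open>A conjugate of a central letter commutes with every other conjugate, so it can travel to
  position c and be absorbed there.\<close>

lemma op_insert_central:
  assumes R: "\<And>i j. rel i j" and k: "k \<in> centre G" and f: "f \<in> UNIV \<rightarrow> carrier G"
  shows "c < n \<Longrightarrow> op n f \<otimes> cj (int c) k = op n (f(c := f c \<otimes>\<^bsub>G\<^esub> k))"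
proof (induction n)
  case (Suc n)
  have fc [simp]: "f i \<in> carrier G" for i using f by auto
  have [simp]: "k \<in> carrier G" using k by (rule centre_closed)
  show ?case
  proof (cases "c = n")
    case True
    define h where "h = f(c := f c \<otimes>\<^bsub>G\<^esub> k)"
    have "op n h = op n f" "h n = f n \<otimes>\<^bsub>G\<^esub> k" by (auto intro!: oprod_cong simp: True h_def)
    then show ?thesis unfolding h_def[symmetric] by (simp add: True cj_mult A.m_assoc)
  next
    case False
    have "op (Suc n) f \<otimes> cj (int c) k = op n f \<otimes> (cj (int n) (f n) \<otimes> cj (int c) k)"
      by (simp add: A.m_assoc)
    also have "\<dots> = op n f \<otimes> cj (int c) k \<otimes> cj (int n) (f n)"
      by (subst rel_central[OF R k, symmetric]) (simp_all add: A.m_assoc)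
    finally show ?thesis using Suc False by simp
  qed
qed simp

text \<open>The new conjugate travels left to position j. Each swap leaves behind a conjugate of a
  central commutator, which \<open>op_insert_central\<close> absorbs.\<close>

lemma op_insert:
  assumes R: "\<And>i j. rel i j" and f: "f \<in> UNIV \<rightarrow> carrier G" and g: "g \<in> carrier G"
  shows "j < n \<Longrightarrow> \<exists>f' \<in> UNIV \<rightarrow> carrier G. op n f \<otimes> cj (int j) g = op n f'"
proof (induction n)
  case (Suc n)
  have fc [simp]: "f i \<in> carrier G" for i using f by auto
  have [simp]: "g \<in> carrier G" by fact
  show ?case
  proof (cases "j = n")
    case True
    define h where "h = f(n := f n \<otimes>\<^bsub>G\<^esub> g)"
    have "op n h = op n f" "h n = f n \<otimes>\<^bsub>G\<^esub> g" by (auto intro!: oprod_cong simp: h_def)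
    then have "op (Suc n) f \<otimes> cj (int j) g = op (Suc n) h"
      by (simp add: True cj_mult A.m_assoc)
    moreover have "h \<in> UNIV \<rightarrow> carrier G" by (auto simp: h_def)
    ultimately show ?thesis by blast
  next
    case False
    then obtain f' where f': "f' \<in> UNIV \<rightarrow> carrier G" "op n f \<otimes> cj (int j) g = op n f'"
      using Suc by auto
    let ?k = "comm (f n) g" and ?c = "(n + j + 1) div 2" and ?h = "f'(n := f n)"
    have h: "?h \<in> UNIV \<rightarrow> carrier G" using f' by auto
    have opc: "op n f' = op n ?h" by (rule oprod_cong) simp
    have c: "(int n + int j + 1) div 2 = int ?c" by (simp add: zdiv_int)
    \<comment> \<open>From j < n the rounded half-sum is at most n, so the commutator falls on a
      position already present.\<close>
    have cl: "?c < Suc n" using False Suc.prems by simp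
    have "op (Suc n) f \<otimes> cj (int j) g = op n f \<otimes> (cj (int n) (f n) \<otimes> cj (int j) g)"
      by (simp add: A.m_assoc)
    also have "\<dots> = op n f \<otimes> cj (int j) g \<otimes> cj (int n) (f n) \<otimes> cj (int ?c) ?k"
      unfolding relD[OF R \<open>f n \<in> carrier G\<close> g] c by (simp add: A.m_assoc)
    also have "\<dots> = op (Suc n) ?h \<otimes> cj (int ?c) ?k" by (simp add: f'(2) opc)
    also have "\<dots> = op (Suc n) (?h(?c := ?h ?c \<otimes>\<^bsub>G\<^esub> ?k))"
      by (rule op_insert_central[OF R _ h cl]) (simp add: commutator_centre)
    finally have "op (Suc n) f \<otimes> cj (int j) g = op (Suc n) (?h(?c := ?h ?c \<otimes>\<^bsub>G\<^esub> ?k))" .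
    moreover have "f' i \<in> carrier G" for i using f' by auto
    then have "?h(?c := ?h ?c \<otimes>\<^bsub>G\<^esub> ?k) \<in> UNIV \<rightarrow> carrier G" by simp
    ultimately show ?thesis by blast
  qed
qed simp

text \<open>Padding with identity letters makes room for an insertion beyond the end of the
  product.\<close>

lemma op_pad:
  assumes "f \<in> UNIV \<rightarrow> carrier G"
  shows "op n f = op (n + m) (\<lambda>i. if i < n then f i else \<one>\<^bsub>G\<^esub>)"
proof (induction m)
  case 0
  have "op n f = op n (\<lambda>i. if i < n then f i else \<one>\<^bsub>G\<^esub>)" by (rule oprod_cong) simp
  then show ?case by simp
next
  case (Suc m)
  have "op (n + m) (\<lambda>i. if i < n then f i else \<one>\<^bsub>G\<^esub>) \<in> carrier A"
    using assms by (intro op_closed) auto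
  then show ?case using Suc by simp
qed

lemma op_conj:
  assumes f: "f \<in> UNIV \<rightarrow> carrier G"
  shows "x \<otimes> op n f \<otimes> inv x = op (Suc n) (case_nat \<one>\<^bsub>G\<^esub> f)"
proof (induction n)
  case (Suc n)
  have fc [simp]: "f i \<in> carrier G" for i using f by auto
  have "x \<otimes> op (Suc n) f \<otimes> inv x = (x \<otimes> op n f \<otimes> inv x) \<otimes> (x \<otimes> cj (int n) (f n) \<otimes> inv x)"
    using conj_mult[of "op n f" "cj (int n) (f n)" 1] by (simp add: A.int_pow_neg)
  also have "x \<otimes> cj (int n) (f n) \<otimes> inv x = cj (int (Suc n)) (f n)"
    using conj_cj[of "f n" 1 "int n"] by (simp add: A.int_pow_neg)
  finally show ?case unfolding Suc by simp
qed simp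

text \<open>The leading power of x allows the product to start at exponent zero although conjugates
  by negative powers of x occur.\<close>

definition normal_form :: "'c set" where
  "normal_form = {x [^] d \<otimes> op n f \<otimes> x [^] j | (d::int) n f (j::int). f \<in> UNIV \<rightarrow> carrier G}"

lemma normal_form_one: "\<one> \<in> normal_form"
proof -
  have "\<one> = x [^] (0::int) \<otimes> op 0 (\<lambda>_. \<one>\<^bsub>G\<^esub>) \<otimes> x [^] (0::int)" by simp
  then show ?thesis unfolding normal_form_def by fastforce
qed

lemma normal_form_x:
  assumes "p \<in> normal_form"
  shows "p \<otimes> x [^] (i::int) \<in> normal_form"
proof -
  obtain d n f and j :: int where p: "p = x [^] (d::int) \<otimes> op n f \<otimes> x [^] j"
    and f: "f \<in> UNIV \<rightarrow> carrier G" using assms unfolding normal_form_def by blast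
  have "op n f \<in> carrier A" using f by (intro op_closed) auto
  then have "p \<otimes> x [^] i = x [^] d \<otimes> op n f \<otimes> x [^] (j + i)"
    by (simp add: p A.int_pow_mult A.m_assoc)
  then show ?thesis using f unfolding normal_form_def by blast
qed

text \<open>Inserting \<open>inv x\<close> and x around the product shifts it by one position; m
  such moves raise the final power of x by m. Thereby the final power can be made
  non-negative.\<close>

lemma normal_form_raise:
  assumes "f \<in> UNIV \<rightarrow> carrier G"
  shows "\<exists>n' f'. f' \<in> UNIV \<rightarrow> carrier G \<and>
    x [^] (d::int) \<otimes> op n f \<otimes> x [^] (j::int) = x [^] (d - int m) \<otimes> op n' f' \<otimes> x [^] (j + int m)"
proof (induction m)
  case 0
  then show ?case using assms by auto
next
  case (Suc m)
  then obtain n' f' where f': "f' \<in> UNIV \<rightarrow> carrier G"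
    and e: "x [^] d \<otimes> op n f \<otimes> x [^] j = x [^] (d - int m) \<otimes> op n' f' \<otimes> x [^] (j + int m)" by blast
  let ?f = "case_nat \<one>\<^bsub>G\<^esub> f'"
  have o: "op n' f' \<in> carrier A" using f' by (intro op_closed) auto
  have d: "d - int m = (d - int (Suc m)) + 1" and j: "j + int (Suc m) = 1 + (j + int m)" by simp_all
  have "x [^] (d - int (Suc m)) \<otimes> op (Suc n') ?f \<otimes> x [^] (j + int (Suc m))
     = x [^] (d - int (Suc m)) \<otimes> (x \<otimes> op n' f' \<otimes> inv x) \<otimes> (x \<otimes> x [^] (j + int m))"
    unfolding op_conj[OF f'] j A.int_pow_mult[OF x_closed] by simp
  also have "\<dots> = (x [^] (d - int (Suc m)) \<otimes> x) \<otimes> op n' f' \<otimes> (inv x \<otimes> (x \<otimes> x [^] (j + int m)))"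
    using o by (simp add: A.m_assoc)
  also have "\<dots> = x [^] (d - int m) \<otimes> op n' f' \<otimes> x [^] (j + int m)"
    unfolding d A.int_pow_mult[OF x_closed] by (simp add: A.m_assoc[symmetric])
  finally have "x [^] d \<otimes> op n f \<otimes> x [^] j
      = x [^] (d - int (Suc m)) \<otimes> op (Suc n') ?f \<otimes> x [^] (j + int (Suc m))" using e by simp
  moreover have "?f \<in> UNIV \<rightarrow> carrier G" using f' by (auto simp: Pi_iff split: nat.split)
  ultimately show ?case by blast
qed

lemma normal_form_t:
  assumes R: "\<And>i j. rel i j" and p: "p \<in> normal_form" and g [simp]: "g \<in> carrier G"
  shows "p \<otimes> t g \<in> normal_form"
proof -
  obtain d0 n0 f0 and j0 :: int where p: "p = x [^] (d0::int) \<otimes> op n0 f0 \<otimes> x [^] j0"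
    and f0: "f0 \<in> UNIV \<rightarrow> carrier G" using p unfolding normal_form_def by blast
  \<comment> \<open>Raising \<open>j0\<close> by its absolute value gives a natural number, as
    \<open>op_insert\<close> requires.\<close>
  define j where "j = nat (j0 + \<bar>j0\<bar>)"
  have j: "j0 + int (nat \<bar>j0\<bar>) = int j" by (cases "0 \<le> j0") (simp_all add: j_def)
  obtain d :: int and n f where f: "f \<in> UNIV \<rightarrow> carrier G"
    and p: "p = x [^] d \<otimes> op n f \<otimes> x [^] int j"
    using normal_form_raise[OF f0, of d0 n0 j0 "nat \<bar>j0\<bar>"] unfolding p j by blast
  let ?f = "\<lambda>i. if i < n then f i else \<one>\<^bsub>G\<^esub>"
  obtain f' where f': "f' \<in> UNIV \<rightarrow> carrier G" "op (n + Suc j) ?f \<otimes> cj (int j) g = op (n + Suc j) f'"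
    using op_insert[OF R, of ?f g j "n + Suc j"] f by fastforce
  have o: "op n f \<in> carrier A" using f by (intro op_closed) auto
  \<comment> \<open>Moved to the left of x^j, the letter g becomes its conjugate at exponent
    j.\<close>
  have "cj (int j) g \<otimes> x [^] int j = x [^] int j \<otimes> t g"
    by (simp add: cpow_def A.m_assoc)
  then have "p \<otimes> t g = x [^] d \<otimes> (op n f \<otimes> cj (int j) g) \<otimes> x [^] int j"
    using o by (simp add: p A.m_assoc)
  also have "op n f \<otimes> cj (int j) g = op (n + Suc j) f'"
    unfolding f'(2)[symmetric] op_pad[OF f, of n "Suc j"] ..
  finally show ?thesis using f'(1) unfolding normal_form_def by blast
qed

end

section \<open>Homomorphisms from free and presented groups\<close>

definition word_eval :: "('c, 'd) monoid_scheme \<Rightarrow> ('s \<Rightarrow> 'c) \<Rightarrow> ('s \<times> bool) list \<Rightarrow> 'c" where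
  "word_eval H f w =
    foldr (\<lambda>(s, b) a. (if b then f s else inv\<^bsub>H\<^esub> f s) \<otimes>\<^bsub>H\<^esub> a) w \<one>\<^bsub>H\<^esub>"

context group
begin

lemma word_eval_closed [simp]:
  assumes "f \<in> S \<rightarrow> carrier G"
  shows "w \<in> free_words S \<Longrightarrow> word_eval G f w \<in> carrier G"
  using assms by (induction w) (auto simp: word_eval_def Pi_iff split: prod.split)

lemma word_eval_append:
  assumes "f \<in> S \<rightarrow> carrier G" "v \<in> free_words S"
  shows "u \<in> free_words S \<Longrightarrow> word_eval G f (u @ v) = word_eval G f u \<otimes> word_eval G f v"
proof (induction u)
  case Nil
  then show ?case using word_eval_closed[OF assms] by (simp add: word_eval_def)
next
  case (Cons p u)
  obtain s b where p: "p = (s, b)" by (cases p)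
  have "f s \<in> carrier G" "u \<in> free_words S" using Cons.prems assms p by auto
  then show ?case
    using Cons.IH word_eval_closed[OF assms] word_eval_closed[OF assms(1), of u] p
    by (simp add: word_eval_def m_assoc)
qed

text \<open>A cancelling pair of letters evaluates to one.\<close>

lemma word_eval_cong:
  assumes f: "f \<in> S \<rightarrow> carrier G"
  shows "(u, v) \<in> free_rel S \<Longrightarrow> word_eval G f u = word_eval G f v"
proof (induction rule: free_rel.induct)
  case (cancel u v s b)
  have fs: "f s \<in> carrier G" using f cancel by auto
  have c: "word_eval G f [(s, b), (s, \<not> b)] = \<one>"
    using fs by (simp add: word_eval_def)
  have e: "word_eval G f ([(s, b), (s, \<not> b)] @ v) = word_eval G f [(s, b), (s, \<not> b)] \<otimes> word_eval G f v"
    using cancel by (intro word_eval_append[OF f]) simp_all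
  have "word_eval G f (u @ [(s, b), (s, \<not> b)] @ v)
      = word_eval G f u \<otimes> word_eval G f ([(s, b), (s, \<not> b)] @ v)"
    using cancel by (intro word_eval_append[OF f]) simp_all
  also have "\<dots> = word_eval G f u \<otimes> word_eval G f v"
    unfolding e c by (subst l_one) (use cancel word_eval_closed[OF f] in auto)
  also have "\<dots> = word_eval G f (u @ v)"
    using cancel by (intro word_eval_append[OF f, symmetric]) simp_all
  finally show ?case .
next
  case (sym u v)
  show ?case by (rule sym.IH[symmetric])
next
  case (trans u v w)
  show ?case by (rule trans.IH(1)[THEN HOL.trans, OF trans.IH(2)])
qed (rule HOL.refl)

end

lemma free_group_universal:
  assumes "group H" and f: "f \<in> S \<rightarrow> carrier H"
  obtains \<psi> where "\<psi> \<in> hom (free_group S) H" "\<And>s. s \<in> S \<Longrightarrow> \<psi> (free_gen S s) = f s"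
proof
  interpret H: group H by fact
  \<comment> \<open>All words in a class have the same value, so the image of the class is a
    singleton.\<close>
  let ?\<psi> = "\<lambda>C. the_elem (word_eval H f ` C)"
  have cls: "?\<psi> (free_rel S `` {u}) = word_eval H f u" if "u \<in> free_words S" for u
  proof -
    have "word_eval H f ` (free_rel S `` {u}) = {word_eval H f u}"
    proof (intro equalityI subsetI)
      fix a assume "a \<in> word_eval H f ` (free_rel S `` {u})"
      then obtain v where "(u, v) \<in> free_rel S" "a = word_eval H f v" by blast
      then show "a \<in> {word_eval H f u}" using H.word_eval_cong[OF f, of u v] by simp
    next
      fix a assume "a \<in> {word_eval H f u}"
      then show "a \<in> word_eval H f ` (free_rel S `` {u})" using free_rel.refl[OF that] by blast
    qed
    then show ?thesis by simp
  qed
  show "?\<psi> \<in> hom (free_group S) H"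
  proof (rule homI)
    fix A B assume "A \<in> carrier (free_group S)" "B \<in> carrier (free_group S)"
    then obtain u v where uv: "u \<in> free_words S" "v \<in> free_words S"
      "A = free_rel S `` {u}" "B = free_rel S `` {v}" by (meson free_carrierE)
    then show "?\<psi> (A \<otimes>\<^bsub>free_group S\<^esub> B) = ?\<psi> A \<otimes>\<^bsub>H\<^esub> ?\<psi> B"
      using H.word_eval_append[OF f uv(2,1)] cls[of u] cls[of v] cls[of "u @ v"]
      by (simp add: free_mult_class)
    show "?\<psi> A \<in> carrier H" using uv cls[of u] H.word_eval_closed[OF f, of u] by simp
  qed
  show "?\<psi> (free_gen S s) = f s" if "s \<in> S" for s
  proof -
    have "f s \<in> carrier H" using that f by auto
    then show ?thesis using that cls[of "[(s, True)]"] by (simp add: free_gen_def word_eval_def)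
  qed
qed

lemma free_gen_inv:
  assumes "s \<in> S"
  shows "inv\<^bsub>free_group S\<^esub> free_gen S s = free_rel S `` {[(s, False)]}"
proof -
  interpret group "free_group S" by (rule group_free_group)
  have "([(s, False), (s, True)], []) \<in> free_rel S"
    using free_rel.cancel[of "[]" S "[]" s False] assms by simp
  then have "free_rel S `` {[(s, False), (s, True)]} = free_rel S `` {[]}"
    by (rule equiv_class_eq[OF equiv_free_rel])
  then have "free_rel S `` {[(s, False)]} \<otimes>\<^bsub>free_group S\<^esub> free_gen S s = \<one>\<^bsub>free_group S\<^esub>"
    using assms by (simp add: free_gen_def free_mult_class free_one)
  then show ?thesis
    using assms by (intro inv_equality) (simp_all add: free_gen_closed free_class_closed)
qed

text \<open>Generators are appended on the right, where normal forms are closed under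
  multiplication.\<close>

lemma free_group_induct [consumes 1, case_names one gen gen_inv]:
  assumes "a \<in> carrier (free_group S)"
    and one: "P \<one>\<^bsub>free_group S\<^esub>"
    and gen: "\<And>a s. \<lbrakk>a \<in> carrier (free_group S); P a; s \<in> S\<rbrakk>
      \<Longrightarrow> P (a \<otimes>\<^bsub>free_group S\<^esub> free_gen S s)"
    and gen_inv: "\<And>a s. \<lbrakk>a \<in> carrier (free_group S); P a; s \<in> S\<rbrakk>
      \<Longrightarrow> P (a \<otimes>\<^bsub>free_group S\<^esub> inv\<^bsub>free_group S\<^esub> free_gen S s)"
  shows "P a"
proof -
  obtain u where u: "u \<in> free_words S" "a = free_rel S `` {u}"
    using assms(1) by (rule free_carrierE)
  have "P (free_rel S `` {u})" using u(1)
  proof (induction u rule: rev_induct)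
    case Nil
    then show ?case using one by (simp add: free_one)
  next
    case (snoc p u)
    obtain s b where p: "p = (s, b)" by (cases p)
    have s: "s \<in> S" "u \<in> free_words S" using snoc.prems p by auto
    have "free_rel S `` {u @ [p]} = free_rel S `` {u} \<otimes>\<^bsub>free_group S\<^esub> free_rel S `` {[p]}"
      using s p by (simp add: free_mult_class)
    then show ?case
      using gen[of "free_rel S `` {u}" s] gen_inv[of "free_rel S `` {u}" s] snoc.IH s p
      by (cases b) (simp_all add: free_gen_inv[unfolded free_gen_def] free_class_closed free_gen_def)
  qed
  then show ?thesis by (simp add: u)
qed

section \<open>Quotients of free groups by normal closures of relators\<close>

locale presentation =
  fixes S :: "'s set" and E
  assumes E_closed: "E \<subseteq> carrier (free_group S) \<times> carrier (free_group S)"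
begin

abbreviation "F \<equiv> free_group S"
abbreviation "P \<equiv> presented_group S E"
abbreviation "nc \<equiv> normal_closure F (relators S E)"

definition proj :: "('s \<times> bool) list set \<Rightarrow> ('s \<times> bool) list set set" where
  "proj a = nc #>\<^bsub>F\<^esub> a"

sublocale F: group F by (rule group_free_group)

lemma relators_closed: "relators S E \<subseteq> carrier F"
  using E_closed by (auto simp: relators_def)

sublocale nc: normal nc F
  by (rule normal_normal_closure[OF F.group_axioms relators_closed])

sublocale P: group P
  unfolding presented_group_def by (rule nc.factorgroup_is_group)

lemma proj_hom: "proj \<in> hom F P"
  using nc.r_coset_hom_Mod by (simp add: presented_group_def proj_def[abs_def])

sublocale proj: group_hom F P proj
  using proj_hom by unfold_locales

lemma proj_surj: "p \<in> carrier P \<Longrightarrow> \<exists>a \<in> carrier F. p = proj a"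
  by (auto simp: presented_group_def carrier_FactGroup proj_def)

lemma proj_relation:
  assumes "(l, r) \<in> E"
  shows "proj l = proj r"
proof -
  have lr: "l \<in> carrier F" "r \<in> carrier F" using assms E_closed by auto
  have "l \<otimes>\<^bsub>F\<^esub> inv\<^bsub>F\<^esub> r \<in> relators S E" using assms by (auto simp: relators_def)
  then have "l \<otimes>\<^bsub>F\<^esub> inv\<^bsub>F\<^esub> r \<in> nc" by (auto simp: normal_closure_def)
  then have "proj (l \<otimes>\<^bsub>F\<^esub> inv\<^bsub>F\<^esub> r) = \<one>\<^bsub>P\<^esub>"
    by (simp add: proj_def presented_group_def nc.rcos_const F.coset_join2 nc.subgroup_axioms lr)
  then have "proj l \<otimes>\<^bsub>P\<^esub> inv\<^bsub>P\<^esub> proj r \<otimes>\<^bsub>P\<^esub> proj r = proj r" using lr by simp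
  then show ?thesis using lr by (simp add: P.m_assoc)
qed

text \<open>The kernel of \<open>\<psi>\<close> is normal and contains the relators, hence their
  normal closure, so \<open>\<psi>\<close> factors through the quotient.\<close>

lemma presented_universal:
  assumes "group H" "\<psi> \<in> hom F H" and "\<And>l r. (l, r) \<in> E \<Longrightarrow> \<psi> l = \<psi> r"
  obtains \<phi> where "\<phi> \<in> hom P H" "\<And>a. a \<in> carrier F \<Longrightarrow> \<phi> (proj a) = \<psi> a"
proof -
  interpret H: group H by fact
  interpret \<psi>: group_hom F H \<psi> using assms(2) by unfold_locales
  have "relators S E \<subseteq> kernel F H \<psi>"
    using E_closed assms(3) by (fastforce simp: relators_def kernel_def)
  then have "nc \<subseteq> kernel F H \<psi>"
    using \<psi>.normal_kernel by (auto simp: normal_closure_def)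
  from \<psi>.FactGroup_universal_kernel[OF nc.normal_axioms this] show ?thesis
    using that unfolding presented_group_def proj_def by metis
qed

end

section \<open>The action of the Cayley machine on infinite words\<close>

lemma BijGroup_carrier: "carrier (BijGroup S) = Bij S"
  by (simp add: BijGroup_def)

lemma BijGroup_one_apply: "w \<in> S \<Longrightarrow> \<one>\<^bsub>BijGroup S\<^esub> w = w"
  by (simp add: BijGroup_def)

lemma BijGroup_mult_apply:
  assumes "f \<in> carrier (BijGroup S)" "g \<in> carrier (BijGroup S)" "w \<in> S"
  shows "(f \<otimes>\<^bsub>BijGroup S\<^esub> g) w = f (g w)"
  using assms by (simp add: BijGroup_def compose_def)

lemma BijGroup_inv_apply:
  assumes f: "f \<in> carrier (BijGroup S)" and w: "w \<in> S"
  shows "(inv\<^bsub>BijGroup S\<^esub> f) (f w) = w" "f ((inv\<^bsub>BijGroup S\<^esub> f) w) = w"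
proof -
  interpret group "BijGroup S" by (rule group_BijGroup)
  have f': "inv\<^bsub>BijGroup S\<^esub> f \<in> carrier (BijGroup S)" using f by simp
  show "(inv\<^bsub>BijGroup S\<^esub> f) (f w) = w" "f ((inv\<^bsub>BijGroup S\<^esub> f) w) = w"
    using BijGroup_mult_apply[OF f f' w] BijGroup_mult_apply[OF f' f w] f w
    by (simp_all add: BijGroup_one_apply)
qed

lemma BijGroup_apply_closed:
  "\<lbrakk>f \<in> carrier (BijGroup S); w \<in> S\<rbrakk> \<Longrightarrow> f w \<in> S"
  using Bij_imp_funcset by (auto simp: BijGroup_carrier)

lemma BijGroup_eqI:
  assumes "f \<in> carrier (BijGroup S)" "g \<in> carrier (BijGroup S)" "\<And>w. w \<in> S \<Longrightarrow> f w = g w"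
  shows "f = g"
  using assms by (intro extensionalityI[of f S g]) (auto simp: BijGroup_carrier Bij_def)

lemma omega_words_apply: "w \<in> omega_words A \<Longrightarrow> w n \<in> A"
  by (auto simp: omega_words_def)

definition wcons :: "'a \<Rightarrow> (nat \<Rightarrow> 'a) \<Rightarrow> nat \<Rightarrow> 'a" where
  "wcons a w = case_nat a w"

lemma wcons_simps [simp]:
  "wcons a w 0 = a"
  "wcons a w (Suc n) = w n"
  "(wcons a w)(0 := b) = wcons b w"
  by (auto simp: wcons_def split: nat.split)

lemma wcons_omega_words:
  "\<lbrakk>a \<in> A; w \<in> omega_words A\<rbrakk> \<Longrightarrow> wcons a w \<in> omega_words A"
  by (auto simp: wcons_def omega_words_def Pi_iff split: nat.split)

lemma omega_words_casesE:
  assumes "w \<in> omega_words A"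
  obtains a v where "a \<in> A" "v \<in> omega_words A" "w = wcons a v"
proof
  show "w = wcons (w 0) (\<lambda>n. w (Suc n))" by (auto simp: wcons_def split: nat.split)
  show "w 0 \<in> A" "(\<lambda>n. w (Suc n)) \<in> omega_words A" using assms by (auto simp: omega_words_def)
qed

section \<open>The maps X and \<open>T\<^sub>g\<close> on infinite words\<close>

context group
begin

abbreviation "\<Omega> \<equiv> omega_words (carrier G)"
abbreviation "Sym\<Omega> \<equiv> BijGroup \<Omega>"

definition first_mult :: "'a \<Rightarrow> (nat \<Rightarrow> 'a) \<Rightarrow> nat \<Rightarrow> 'a" where
  "first_mult g = (\<lambda>w \<in> \<Omega>. w(0 := g \<otimes> w 0))"

text \<open>The map X. State 1 forms running products, so its inverse takes quotients of
  neighbouring letters.\<close>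

definition quot_map :: "(nat \<Rightarrow> 'a) \<Rightarrow> nat \<Rightarrow> 'a" where
  "quot_map = inv\<^bsub>Sym\<Omega>\<^esub> state_map (cayley_machine G) \<one>"

lemma group_Sym: "group Sym\<Omega>"
  by (rule group_BijGroup)

lemma state_map_closed: "g \<in> carrier G \<Longrightarrow> state_map (cayley_machine G) g \<in> carrier Sym\<Omega>"
  by (simp add: BijGroup_carrier state_map_cayley_Bij group_axioms)

lemma quot_map_closed: "quot_map \<in> carrier Sym\<Omega>"
  using state_map_closed by (simp add: quot_map_def group.inv_closed[OF group_Sym])

lemma quot_map_inverse:
  assumes "w \<in> \<Omega>"
  shows "state_map (cayley_machine G) \<one> (quot_map w) = w"
  unfolding quot_map_def using state_map_closed[of \<one>] assms by (simp add: BijGroup_inv_apply)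

lemma quot_map_apply:
  assumes w: "w \<in> \<Omega>"
  shows "quot_map w 0 = w 0" "quot_map w (Suc n) = inv (w n) \<otimes> w (Suc n)"
proof -
  have q: "quot_map w \<in> \<Omega>" using w by (rule BijGroup_apply_closed[OF quot_map_closed])
  have c: "w i \<in> carrier G" "quot_map w i \<in> carrier G" for i
    using omega_words_apply[OF w] omega_words_apply[OF q] by auto
  show "quot_map w 0 = w 0"
    using state_map_cayley(1)[OF q, of \<one>] c by (simp add: quot_map_inverse[OF w])
  have "w (Suc n) = w n \<otimes> quot_map w (Suc n)"
    using state_map_cayley(2)[OF q, of \<one> n] by (simp add: quot_map_inverse[OF w])
  then show "quot_map w (Suc n) = inv (w n) \<otimes> w (Suc n)"
    using c by (simp add: m_assoc[symmetric])
qed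

lemma first_mult_apply: "w \<in> \<Omega> \<Longrightarrow> first_mult g w = w(0 := g \<otimes> w 0)"
  by (simp add: first_mult_def)

lemma first_mult_omega: "\<lbrakk>g \<in> carrier G; w \<in> \<Omega>\<rbrakk> \<Longrightarrow> w(0 := g \<otimes> w 0) \<in> \<Omega>"
  by (auto simp: omega_words_def Pi_iff)

lemma first_mult_closed:
  assumes g: "g \<in> carrier G"
  shows "first_mult g \<in> carrier Sym\<Omega>"
proof -
  have "bij_betw (first_mult g) \<Omega> \<Omega>"
  proof (rule bij_betw_byWitness[where f' = "first_mult (inv g)"])
    show "\<forall>w \<in> \<Omega>. first_mult (inv g) (first_mult g w) = w"
      "\<forall>w \<in> \<Omega>. first_mult g (first_mult (inv g) w) = w"
      using g by (auto simp: first_mult_apply first_mult_omega omega_words_apply m_assoc[symmetric])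
    show "first_mult g ` \<Omega> \<subseteq> \<Omega>" "first_mult (inv g) ` \<Omega> \<subseteq> \<Omega>"
      using g by (auto simp: first_mult_apply first_mult_omega)
  qed
  then show ?thesis by (simp add: BijGroup_carrier Bij_def first_mult_def)
qed

lemma first_mult_hom: "first_mult \<in> hom G Sym\<Omega>"
proof (rule homI)
  interpret S: group Sym\<Omega> by (rule group_Sym)
  fix g h assume gh: "g \<in> carrier G" "h \<in> carrier G"
  show "first_mult (g \<otimes> h) = first_mult g \<otimes>\<^bsub>Sym\<Omega>\<^esub> first_mult h"
  proof (rule BijGroup_eqI)
    fix w assume "w \<in> \<Omega>"
    then show "first_mult (g \<otimes> h) w = (first_mult g \<otimes>\<^bsub>Sym\<Omega>\<^esub> first_mult h) w"
      using gh by (simp add: BijGroup_mult_apply first_mult_closed first_mult_apply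
          first_mult_omega omega_words_apply m_assoc)
  qed (use gh in \<open>auto intro: first_mult_closed\<close>)
qed (rule first_mult_closed)

text \<open>Starting in state g amounts to starting in state 1 after multiplying the first letter by
  g.\<close>

lemma state_map_conv_first_mult:
  assumes g: "g \<in> carrier G"
  shows "quot_map \<otimes>\<^bsub>Sym\<Omega>\<^esub> state_map (cayley_machine G) g = first_mult g"
proof -
  interpret S: group Sym\<Omega> by (rule group_Sym)
  let ?U = "state_map (cayley_machine G)"
  have "?U g = ?U \<one> \<otimes>\<^bsub>Sym\<Omega>\<^esub> first_mult g"
  proof (rule BijGroup_eqI)
    fix w assume w: "w \<in> \<Omega>"
    define u where "u = first_mult g w"
    have u: "u \<in> \<Omega>" "u 0 = g \<otimes> w 0" "\<And>n. u (Suc n) = w (Suc n)"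
      using g w by (simp_all add: u_def first_mult_apply first_mult_omega)
    have "?U g w n = ?U \<one> u n" for n
      using g omega_words_apply[OF w]
      by (induction n) (simp_all add: state_map_cayley[OF w] state_map_cayley[OF u(1)] u(2,3))
    then show "?U g w = (?U \<one> \<otimes>\<^bsub>Sym\<Omega>\<^esub> first_mult g) w"
      using w g by (auto simp: BijGroup_mult_apply state_map_closed first_mult_closed u_def)
  qed (use g in \<open>auto intro: first_mult_closed state_map_closed\<close>)
  then show ?thesis
    using g by (simp add: quot_map_def S.inv_solve_left' state_map_closed first_mult_closed)
qed

lemma quot_map_wcons:
  assumes a: "a \<in> carrier G" and w: "w \<in> \<Omega>"
  shows "quot_map (wcons a w) = wcons a ((first_mult (inv a) \<otimes>\<^bsub>Sym\<Omega>\<^esub> quot_map) w)"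
proof
  fix n
  have aw: "wcons a w \<in> \<Omega>" using assms by (rule wcons_omega_words)
  have q: "quot_map w \<in> \<Omega>" using w by (rule BijGroup_apply_closed[OF quot_map_closed])
  have e: "(first_mult (inv a) \<otimes>\<^bsub>Sym\<Omega>\<^esub> quot_map) w = (quot_map w)(0 := inv a \<otimes> w 0)"
    using a w q by (simp add: BijGroup_mult_apply first_mult_closed quot_map_closed
        first_mult_apply quot_map_apply)
  \<comment> \<open>Letter 0 is kept and letter 1 is divided by a; only the letters from 2 on are
    quotients taken inside the tail.\<close>
  show "quot_map (wcons a w) n = wcons a ((first_mult (inv a) \<otimes>\<^bsub>Sym\<Omega>\<^esub> quot_map) w) n"
    unfolding e
    by (cases n; cases "n - 1") (simp_all add: quot_map_apply[OF aw] quot_map_apply[OF w])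
qed

end

sublocale central_squares_group \<subseteq> act: conjugates Sym\<Omega> G first_mult quot_map
  by (rule conjugates.intro[OF group_Sym central_squares_group_axioms
        conjugates_axioms.intro[OF first_mult_hom quot_map_closed]])

section \<open>The relations in the automata group, by induction on the distance\<close>

context central_squares_group
begin

abbreviation mult_Sym (infixl "\<bullet>" 70) where "f \<bullet> g \<equiv> f \<otimes>\<^bsub>Sym\<Omega>\<^esub> g"

text \<open>X keeps the first letter, so every iteration acts on the tail by the same map.\<close>

lemma quot_pow_wcons:
  assumes a: "a \<in> carrier G"
  shows "w \<in> \<Omega> \<Longrightarrow> (quot_map [^]\<^bsub>Sym\<Omega>\<^esub> (n::nat)) (wcons a w)
    = wcons a (((first_mult (inv a) \<bullet> quot_map) [^]\<^bsub>Sym\<Omega>\<^esub> n) w)"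
proof (induction n arbitrary: w)
  case 0
  then show ?case using a by (simp add: BijGroup_one_apply wcons_omega_words)
next
  case (Suc n)
  let ?z = "first_mult (inv a) \<bullet> quot_map"
  have z: "?z \<in> carrier Sym\<Omega>" using a by simp
  have "?z w \<in> \<Omega>" using z Suc.prems by (rule BijGroup_apply_closed)
  then show ?case
    using a z Suc by (simp add: BijGroup_mult_apply[of "_ [^]\<^bsub>Sym\<Omega>\<^esub> n"] wcons_omega_words quot_map_wcons)
qed

lemma quot_pow_neg_wcons:
  assumes a: "a \<in> carrier G" and w: "w \<in> \<Omega>"
  shows "(quot_map [^]\<^bsub>Sym\<Omega>\<^esub> (- int n)) (wcons a w)
    = wcons a ((inv\<^bsub>Sym\<Omega>\<^esub> ((first_mult (inv a) \<bullet> quot_map) [^]\<^bsub>Sym\<Omega>\<^esub> n)) w)"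
proof -
  let ?Z = "(first_mult (inv a) \<bullet> quot_map) [^]\<^bsub>Sym\<Omega>\<^esub> n"
  let ?X = "quot_map [^]\<^bsub>Sym\<Omega>\<^esub> n"
  have Z: "?Z \<in> carrier Sym\<Omega>" "inv\<^bsub>Sym\<Omega>\<^esub> ?Z \<in> carrier Sym\<Omega>" using a by simp_all
  define v where "v = (inv\<^bsub>Sym\<Omega>\<^esub> ?Z) w"
  have v: "v \<in> \<Omega>" unfolding v_def using Z(2) w by (rule BijGroup_apply_closed)
  have "?Z v = w"
    unfolding v_def using act.A.nat_pow_closed a w by (intro BijGroup_inv_apply) simp_all
  then have "?X (wcons a v) = wcons a w" by (simp add: quot_pow_wcons[OF a v])
  moreover have "(inv\<^bsub>Sym\<Omega>\<^esub> ?X) (?X (wcons a v)) = wcons a v"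
    using wcons_omega_words[OF a v] by (simp add: BijGroup_inv_apply)
  ultimately show ?thesis
    by (simp add: v_def act.A.int_pow_neg int_pow_int)
qed

text \<open>The recursion that drives the induction: the action on the tail of a word is again a product
  of the same generators, with exponents below \<open>n\<close>.\<close>

lemma cpow_wcons:
  assumes N: "act.rel_below N" and n: "n \<le> N"
    and h [simp]: "h \<in> carrier G" and a [simp]: "a \<in> carrier G" and w: "w \<in> \<Omega>"
  shows "act.cj (int n) h (wcons a w)
    = wcons (h \<otimes> a) ((act.yy n (inv h) \<bullet> act.yy ((n + 1) div 2) (act.comm a h)) w)"
proof -
  let ?p = "act.yy n (inv h)" and ?q = "act.yy ((n + 1) div 2) (act.comm a h)"
  let ?y = "\<lambda>a. act.yy n (inv a)" and ?X = "quot_map [^]\<^bsub>Sym\<Omega>\<^esub> n"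
  let ?Z = "\<lambda>a. (first_mult (inv a) \<bullet> quot_map) [^]\<^bsub>Sym\<Omega>\<^esub> n"
  have Z: "?Z b \<in> carrier Sym\<Omega>" "?Z b = ?y b \<bullet> ?X" if "b \<in> carrier G" for b
    using that by (simp_all add: act.yy_pow)
  define v where "v = (inv\<^bsub>Sym\<Omega>\<^esub> ?Z a) w"
  have v: "v \<in> \<Omega>" unfolding v_def using w by (intro BijGroup_apply_closed[OF _ w]) simp
  have av: "wcons a v \<in> \<Omega>" "wcons a w \<in> \<Omega>" using v w by (simp_all add: wcons_omega_words)
  have "act.cj (int n) h (wcons a w) = ?X (first_mult h ((quot_map [^]\<^bsub>Sym\<Omega>\<^esub> (- int n)) (wcons a w)))"
    unfolding cpow_def int_pow_int
    using av by (simp add: BijGroup_mult_apply BijGroup_apply_closed)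
  also have "\<dots> = ?X (wcons (h \<otimes> a) v)"
    using av by (simp add: quot_pow_neg_wcons w v_def[symmetric] first_mult_apply)
  also have "\<dots> = wcons (h \<otimes> a) (?Z (h \<otimes> a) v)"
    using v by (simp add: quot_pow_wcons)
  also have "?Z (h \<otimes> a) v = (?Z (h \<otimes> a) \<bullet> inv\<^bsub>Sym\<Omega>\<^esub> ?Z a) w"
    using w by (simp add: v_def BijGroup_mult_apply)
  \<comment> \<open>Both n-th powers end in X^n, which cancels.\<close>
  also have "?Z (h \<otimes> a) \<bullet> inv\<^bsub>Sym\<Omega>\<^esub> ?Z a = ?y (h \<otimes> a) \<bullet> inv\<^bsub>Sym\<Omega>\<^esub> ?y a"
    by (simp add: Z(2) act.A.inv_mult_group act.A.m_assoc)
      (simp add: act.A.m_assoc[symmetric])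
  \<comment> \<open>As inv (h a) = inv a inv h, \<open>yy_mult\<close> applies with the inverted
    letters; inverting both arguments does not change the commutator.\<close>
  also have "?y (h \<otimes> a) = ?p \<bullet> (?q \<bullet> ?y a)"
    using act.yy_mult[OF N _ _ n, of "inv a" "inv h"]
    by (simp add: inv_mult_group commutator_inv_inv)
  also have "?p \<bullet> (?q \<bullet> ?y a) \<bullet> inv\<^bsub>Sym\<Omega>\<^esub> ?y a = ?p \<bullet> ?q"
    by (simp add: act.A.m_assoc)
  finally show ?thesis .
qed

text \<open>Both sides are compared on a word with first letter a. The first letters agree by the
  swap rule in G; the tails are products with exponents below N, which \<open>yy_mult\<close>
  compares.\<close>

lemma rel_step:
  assumes N: "act.rel_below N"
  shows "act.rel 0 (int N)"
  unfolding act.rel_def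
proof (intro ballI)
  fix g h assume gh [simp]: "g \<in> carrier G" "h \<in> carrier G"
  define r where "r = (N + 1) div 2"
  define k where "k = act.comm g h"
  have rN: "r \<le> N" by (simp add: r_def)
  have ri: "(0 + int N + 1) div 2 = int r" by (simp add: r_def zdiv_int)
  have k [simp]: "k \<in> carrier G" and kZ: "k \<in> centre G" and kk: "k \<otimes> k = \<one>"
    by (simp_all add: k_def commutator_centre commutator_square)
  have ik: "inv k = k" using kk by (simp add: inv_equality)
  show "act.cj 0 g \<bullet> act.cj (int N) h = act.cj (int N) h \<bullet> act.cj 0 g
      \<bullet> act.cj ((0 + int N + 1) div 2) (act.comm g h)"
    unfolding ri k_def[symmetric]
  proof (rule BijGroup_eqI)
    fix w assume "w \<in> \<Omega>"
    then obtain a v where a [simp]: "a \<in> carrier G" and v: "v \<in> \<Omega>" and w: "w = wcons a v"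
      by (rule omega_words_casesE)
    let ?p = "act.yy N (inv h)" and ?q = "\<lambda>b. act.yy r (act.comm b h)" and ?y = "act.yy r k"
    have closed: "(?p \<bullet> ?q b) u \<in> \<Omega>" "?y u \<in> \<Omega>" if "u \<in> \<Omega>" "b \<in> carrier G" for u b
      by (rule BijGroup_apply_closed[OF _ that(1)], simp add: that)+
    have g0: "act.cj 0 g (wcons b u) = wcons (g \<otimes> b) u" if "b \<in> carrier G" "u \<in> \<Omega>" for b u
      using that by (simp add: act.cj_zero first_mult_apply wcons_omega_words)
    have hN: "act.cj (int N) h (wcons b u) = wcons (h \<otimes> b) ((?p \<bullet> ?q b) u)"
      if "b \<in> carrier G" "u \<in> \<Omega>" for b u
      using cpow_wcons[OF N order.refl] that by (simp add: r_def)
    \<comment> \<open>The letter k is its own inverse and commutes with a, so only one product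
      remains on the tail.\<close>
    have kr: "act.cj (int r) k (wcons a v) = wcons (k \<otimes> a) (?y v)"
      using cpow_wcons[OF N rN k a v]
      by (simp add: ik commutator_centre_right[OF kZ] act.op_one)
    \<comment> \<open>By linearity, replacing a by g k a changes the commutator with h by k =
      [g, h], as k is central; k squares to one.\<close>
    have "act.comm a h = k \<otimes> act.comm (g \<otimes> (k \<otimes> a)) h"
      by (simp add: commutator_mult_left commutator_centre_left[OF kZ] k_def[symmetric]
          m_assoc[symmetric] kk)
    then have q: "?q a = ?q (g \<otimes> (k \<otimes> a)) \<bullet> ?y"
      using act.yy_mult[OF N k _ rN, of "act.comm (g \<otimes> (k \<otimes> a)) h"]
      by (simp add: commutator_centre_left[OF kZ] act.op_one)
    have "h \<otimes> (g \<otimes> (k \<otimes> a)) = g \<otimes> (h \<otimes> a)"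
      using commutator_swap[of g h] by (simp add: k_def m_assoc[symmetric])
    moreover have "(?p \<bullet> ?q (g \<otimes> (k \<otimes> a))) (?y v) = (?p \<bullet> ?q a) v"
      unfolding q using v by (simp add: BijGroup_mult_apply BijGroup_apply_closed)
    ultimately have "act.cj (int N) h (act.cj 0 g (act.cj (int r) k w)) = act.cj 0 g (act.cj (int N) h w)"
      using v closed[of v a] by (simp add: w kr g0 hN)
    then show "(act.cj 0 g \<bullet> act.cj (int N) h) w = (act.cj (int N) h \<bullet> act.cj 0 g \<bullet> act.cj (int r) k) w"
      using \<open>w \<in> \<Omega>\<close> by (simp add: BijGroup_mult_apply BijGroup_apply_closed)
  qed auto
qed

text \<open>The induction starts from a vacuous statement; even equal exponents are settled by
  \<open>rel_step\<close>.\<close>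

lemma rel_all: "act.rel i j"
proof -
  have "act.rel_below N" for N
  proof (induction N)
    case 0
    then show ?case by (simp add: act.rel_below_def)
  next
    case (Suc N)
    then show ?case using act.rel_below_SucI rel_step by blast
  qed
  then have "act.rel_below (Suc (nat \<bar>i - j\<bar>))" .
  then show ?thesis by (simp add: act.rel_below_def)
qed

end

section \<open>Which letters the conjugates and the powers of X change\<close>

context central_squares_group
begin

text \<open>Conjugating once more by X moves the last changed letter one place on: letter n + 1 of X
  c is inv (c n) c (n + 1), and only the first of these factors differs from that of b.\<close>

lemma cpow_finitary:
  assumes h: "h \<in> carrier G"
  shows "w \<in> \<Omega> \<Longrightarrow> (\<forall>i > n. act.cj (int n) h w i = w i) \<and> (h \<noteq> \<one> \<longrightarrow> act.cj (int n) h w n \<noteq> w n)"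
proof (induction n arbitrary: w)
  case 0
  then show ?case
    using h omega_words_apply[OF 0, of 0] by (simp add: act.cj_zero first_mult_apply)
next
  case (Suc n)
  define b where "b = (inv\<^bsub>Sym\<Omega>\<^esub> quot_map) w"
  have b: "b \<in> \<Omega>" unfolding b_def by (rule BijGroup_apply_closed[OF _ Suc.prems]) simp
  have w: "w = quot_map b" unfolding b_def using Suc.prems by (simp add: BijGroup_inv_apply)
  define c where "c = act.cj (int n) h b"
  have c: "c \<in> \<Omega>" unfolding c_def by (rule BijGroup_apply_closed[OF _ b]) (simp add: h)
  have "act.cj (int (Suc n)) h = quot_map \<bullet> act.cj (int n) h \<bullet> inv\<^bsub>Sym\<Omega>\<^esub> quot_map"
    using act.conj_cj[OF h, of 1 "int n"] by (simp add: act.A.int_pow_neg)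
  then have e: "act.cj (int (Suc n)) h w = quot_map c"
    using h b Suc.prems by (simp add: BijGroup_mult_apply b_def[symmetric] c_def)
  have cn: "\<forall>i > n. c i = b i" "h \<noteq> \<one> \<longrightarrow> c n \<noteq> b n" using Suc.IH[OF b] by (auto simp: c_def)
  have cl: "c i \<in> carrier G" "b i \<in> carrier G" for i
    using omega_words_apply[OF c] omega_words_apply[OF b] by auto
  show ?case
  proof (intro conjI allI impI)
    fix i assume "Suc n < i"
    then obtain m where "i = Suc m" "n < m" by (cases i) auto
    then show "act.cj (int (Suc n)) h w i = w i"
      unfolding e using cn(1) by (simp add: w quot_map_apply b c)
  next
    assume "h \<noteq> \<one>"
    then have "inv (c n) \<noteq> inv (b n)" using cn(2) cl by (metis inv_inv)
    then show "act.cj (int (Suc n)) h w (Suc n) \<noteq> w (Suc n)"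
      unfolding e using cn(1) cl by (simp add: w quot_map_apply b c)
  qed
qed

lemma op_finitary:
  assumes f: "f \<in> UNIV \<rightarrow> carrier G"
  shows "w \<in> \<Omega> \<Longrightarrow> n \<le> i \<Longrightarrow> act.op n f w i = w i"
proof (induction n arbitrary: w)
  case (Suc n)
  have fc: "f i \<in> carrier G" for i using f by auto
  have "act.cj (int n) (f n) w \<in> \<Omega>"
    using BijGroup_apply_closed[of "act.cj (int n) (f n)" \<Omega> w] Suc.prems(1) fc by simp
  then show ?case
    using Suc fc cpow_finitary[OF fc Suc.prems(1)] by (simp add: BijGroup_mult_apply)
qed (simp add: BijGroup_one_apply)

text \<open>Peel off the last factor: it acts first and is the only one that can change letter n, so
  its letter is trivial.\<close>

lemma op_eq_one:
  assumes f: "f \<in> UNIV \<rightarrow> carrier G"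
  shows "act.op n f = \<one>\<^bsub>Sym\<Omega>\<^esub> \<Longrightarrow> i < n \<Longrightarrow> f i = \<one>"
proof (induction n)
  case (Suc n)
  have fc: "f i \<in> carrier G" for i using f by auto
  let ?w = "\<lambda>_::nat. \<one>" and ?c = "act.cj (int n) (f n)"
  have w: "?w \<in> \<Omega>" by (simp add: omega_words_def)
  have c: "?c ?w \<in> \<Omega>" using BijGroup_apply_closed[of ?c \<Omega> ?w] fc w by simp
  have "?c ?w n = act.op (Suc n) f ?w n"
    using op_finitary[OF f c, of n n] fc w by (simp add: BijGroup_mult_apply)
  also have "\<dots> = ?w n" using Suc.prems(1) w by (simp only: BijGroup_one_apply)
  finally have fn: "f n = \<one>" using cpow_finitary[OF fc w, of n n] by blast
  then have "act.op n f = \<one>\<^bsub>Sym\<Omega>\<^esub>" using Suc.prems(1) fc by simp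
  then show ?case using Suc fn by (cases "i = n") auto
qed simp

text \<open>Each application of X moves the last non-trivial letter one place to the right, since it
  is divided into a trivial letter there.\<close>

lemma quot_pow_delta:
  fixes p :: nat
  assumes g: "g \<in> carrier G" "g \<noteq> \<one>"
  defines "w \<equiv> \<lambda>i. if i = p then g else \<one>"
  shows "(quot_map [^]\<^bsub>Sym\<Omega>\<^esub> (n::nat)) w (p + n) \<noteq> \<one>
    \<and> (\<forall>i > p + n. (quot_map [^]\<^bsub>Sym\<Omega>\<^esub> n) w i = \<one>)"
proof (induction n)
  have w: "w \<in> \<Omega>" using g by (simp add: w_def omega_words_def)
  case 0
  show ?case using w g by (simp add: BijGroup_one_apply) (simp add: w_def)
next
  have w: "w \<in> \<Omega>" using g by (simp add: w_def omega_words_def)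
  case (Suc n)
  define v where "v = (quot_map [^]\<^bsub>Sym\<Omega>\<^esub> n) w"
  have v: "v \<in> \<Omega>" unfolding v_def by (rule BijGroup_apply_closed[OF _ w]) simp
  have vc: "v i \<in> carrier G" for i using v by (rule omega_words_apply)
  have e: "(quot_map [^]\<^bsub>Sym\<Omega>\<^esub> Suc n) w = quot_map v"
    using w unfolding act.A.nat_pow_Suc2[OF quot_map_closed] by (simp add: BijGroup_mult_apply v_def)
  have IH: "v (p + n) \<noteq> \<one>" "\<And>i. i > p + n \<Longrightarrow> v i = \<one>" using Suc by (auto simp: v_def)
  have "quot_map v i = \<one>" if "i > p + Suc n" for i
  proof -
    obtain m where "i = Suc m" "m > p + n" using \<open>i > p + Suc n\<close> by (cases i) auto
    then show ?thesis using IH(2) by (simp add: quot_map_apply[OF v])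
  qed
  moreover have "quot_map v (p + Suc n) \<noteq> \<one>"
    using IH vc by (simp add: quot_map_apply[OF v] inv_eq_1_iff)
  ultimately show ?case unfolding e by blast
qed

lemma op_eq_quot_pow:
  assumes f: "f \<in> UNIV \<rightarrow> carrier G" and g: "g \<in> carrier G" "g \<noteq> \<one>"
    and e: "act.op n f = quot_map [^]\<^bsub>Sym\<Omega>\<^esub> (j::int)"
  shows "j = 0"
proof (rule ccontr)
  assume "j \<noteq> 0"
  define m where "m = nat \<bar>j\<bar>"
  have m: "m > 0" using \<open>j \<noteq> 0\<close> by (simp add: m_def)
  \<comment> \<open>With the letter at position n, X^m makes position n + m non-trivial, outside the
    reach of the product.\<close>
  define w where "w = (\<lambda>i. if i = n then g else \<one>)"
  have w: "w \<in> \<Omega>" using g by (simp add: w_def omega_words_def)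
  define v where "v = (quot_map [^]\<^bsub>Sym\<Omega>\<^esub> m) w"
  have v: "v \<in> \<Omega>" unfolding v_def by (rule BijGroup_apply_closed[OF _ w]) simp
  have "v (n + m) = w (n + m)"
  proof (cases "j > 0")
    case True
    then have "act.op n f w = v"
      unfolding e v_def m_def int_pow_int[symmetric] by simp
    then show ?thesis using op_finitary[OF f w, of n "n + m"] by simp
  next
    case False
    then have j: "j = - int m" by (simp add: m_def)
    \<comment> \<open>For negative j the product undoes X^m, so it would have to change letter n + m
      of v.\<close>
    have "act.op n f v = w"
      unfolding e j v_def act.A.int_pow_neg_int[OF quot_map_closed]
      using w by (simp add: BijGroup_inv_apply)
    then show ?thesis using op_finitary[OF f v, of n "n + m"] by simp
  qed
  then show False using quot_pow_delta[OF g, of m n] m by (simp add: v_def w_def)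
qed

end

section \<open>The presentation\<close>

lemma (in group_hom) commutator_hom:
  "\<lbrakk>a \<in> carrier G; b \<in> carrier G\<rbrakk>
    \<Longrightarrow> h (commutator G a b) = commutator H (h a) (h b)"
  by (simp add: commutator_def)

lemma ceiling_half: "\<lceil>real_of_int s / 2\<rceil> = (s + 1) div 2"
proof -
  have "\<lceil>real_of_int s / real_of_int 2\<rceil> = - (- s div 2)"
    by (rule ceiling_divide_eq_div)
  also have "\<dots> = (s + 1) div 2" by presburger
  finally show ?thesis by simp
qed

context group
begin

lemma sym_x_closed: "sym_x G \<in> carrier (cayley_free G)"
  by (simp add: sym_x_def free_gen_closed cayley_gens_def)

lemma sym_elt_closed: "g \<in> carrier G \<Longrightarrow> sym_elt G g \<in> carrier (cayley_free G)"
  using group.is_monoid[OF group_free_group]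
  by (auto simp: sym_elt_def cayley_gens_def intro!: free_gen_closed monoid.one_closed)

lemma x_conj_conv_cpow: "x_conj G m (sym_elt G g) = cpow (cayley_free G) (sym_elt G) (sym_x G) m g"
  by (simp add: x_conj_def cpow_def)

lemma x_conj_closed:
  assumes "g \<in> carrier G"
  shows "x_conj G m (sym_elt G g) \<in> carrier (cayley_free G)"
proof -
  interpret F: group "cayley_free G" by (rule group_free_group)
  show ?thesis using assms by (simp add: x_conj_def sym_x_closed sym_elt_closed)
qed

lemma cayley_relations_closed:
  "cayley_relations G \<subseteq> carrier (cayley_free G) \<times> carrier (cayley_free G)"
proof -
  interpret F: group "cayley_free G" by (rule group_free_group)
  show ?thesis
    by (auto simp: table_relations_def commutator_relations_def sym_elt_closed x_conj_closed)
qed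

end

section \<open>The presented group: relations, normal forms and the map to the bijections\<close>

locale cayley_presentation = central_squares_group

sublocale cayley_presentation \<subseteq> pres: presentation "cayley_gens G" "cayley_relations G"
  by unfold_locales (rule cayley_relations_closed)

context cayley_presentation
begin

abbreviation "pres_elt g \<equiv> pres.proj (sym_elt G g)"
abbreviation "pres_x \<equiv> pres.proj (sym_x G)"

lemma pres_elt_hom: "pres_elt \<in> hom G pres.P"
proof (rule homI)
  fix g h assume gh: "g \<in> carrier G" "h \<in> carrier G"
  then have "(sym_elt G g \<otimes>\<^bsub>cayley_free G\<^esub> sym_elt G h, sym_elt G (g \<otimes> h)) \<in> cayley_relations G"
    by (auto simp: table_relations_def)
  from pres.proj_relation[OF this] show "pres_elt (g \<otimes> h) = pres_elt g \<otimes>\<^bsub>pres.P\<^esub> pres_elt h"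
    using gh by (simp add: sym_elt_closed)
qed (simp add: sym_elt_closed)

end

sublocale cayley_presentation \<subseteq> pc: conjugates pres.P G pres_elt pres_x
  by (rule conjugates.intro[OF pres.P.group_axioms central_squares_group_axioms
        conjugates_axioms.intro[OF pres_elt_hom]]) (simp add: sym_x_closed)

context cayley_presentation
begin

lemma pc_rel: "pc.rel i j"
  unfolding pc.rel_def
proof (intro ballI)
  fix g h assume gh: "g \<in> carrier G" "h \<in> carrier G"
  let ?c = "\<lambda>i g. x_conj G i (sym_elt G g)"
  have cp: "pc.cj m a = pres.proj (?c m a)" if "a \<in> carrier G" for m a
    using cpow_hom[of pres.F pres.P pres.proj "sym_x G" "sym_elt G" a m] that pres.proj_hom
      sym_x_closed sym_elt_closed pres.F.group_axioms pres.P.group_axioms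
    unfolding x_conj_conv_cpow by (simp add: comp_def)
  show "pc.cj i g \<otimes>\<^bsub>pres.P\<^esub> pc.cj j h
    = pc.cj j h \<otimes>\<^bsub>pres.P\<^esub> pc.cj i g \<otimes>\<^bsub>pres.P\<^esub> pc.cj ((i + j + 1) div 2) (commutator G g h)"
  \<comment> \<open>The commutator relations are imposed for non-identity letters only; with an
    identity letter both sides agree trivially.\<close>
  proof (cases "g = \<one> \<or> h = \<one>")
    case True
    have "\<one> \<in> centre G" by (simp add: centre_def)
    then show ?thesis using True gh by (auto simp: commutator_centre_left commutator_centre_right)
  next
    case False
    then have "(commutator (cayley_free G) (?c i g) (?c j h), ?c ((i + j + 1) div 2) (commutator G g h))
        \<in> cayley_relations G"
      using gh by (auto simp: commutator_relations_def ceiling_half add.commute simp del: of_int_add)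
    from pres.proj_relation[OF this]
    have "commutator pres.P (pc.cj i g) (pc.cj j h) = pc.cj ((i + j + 1) div 2) (commutator G g h)"
      using gh by (simp add: cp pres.proj.commutator_hom x_conj_closed)
    then show ?thesis using gh by (simp add: pres.P.commutator_eq_iff)
  qed
qed

text \<open>Inverses of letters from G are again letters from G by the table relations, so only x
  needs an inverse case.\<close>

lemma pres_P_induct [consumes 1, case_names one x x_inv elt]:
  assumes "p \<in> carrier pres.P"
    and one: "Q \<one>\<^bsub>pres.P\<^esub>"
    and x: "\<And>p. \<lbrakk>p \<in> carrier pres.P; Q p\<rbrakk> \<Longrightarrow> Q (p \<otimes>\<^bsub>pres.P\<^esub> pres_x)"
    and x_inv: "\<And>p. \<lbrakk>p \<in> carrier pres.P; Q p\<rbrakk> \<Longrightarrow> Q (p \<otimes>\<^bsub>pres.P\<^esub> inv\<^bsub>pres.P\<^esub> pres_x)"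
    and elt: "\<And>p g. \<lbrakk>p \<in> carrier pres.P; Q p; g \<in> carrier G\<rbrakk> \<Longrightarrow> Q (p \<otimes>\<^bsub>pres.P\<^esub> pres_elt g)"
  shows "Q p"
proof -
  obtain a where a: "a \<in> carrier pres.F" "p = pres.proj a" using pres.proj_surj assms(1) by blast
  have inv_elt: "inv\<^bsub>pres.P\<^esub> pres_elt g = pres_elt (inv g)" if "g \<in> carrier G" for g
  proof -
    interpret t: group_hom G pres.P pres_elt using pres_elt_hom by unfold_locales
    show ?thesis using that by simp
  qed
  have gens: "free_gen (cayley_gens G) s = sym_x G \<or> (\<exists>g \<in> carrier G. free_gen (cayley_gens G) s = sym_elt G g)"
    if "s \<in> cayley_gens G" for s
    using that by (auto simp: cayley_gens_def sym_x_def sym_elt_def)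
  have "Q (pres.proj a)" using a(1)
  proof (induction rule: free_group_induct)
    case one
    then show ?case using assms(2) by simp
  next
    case (gen a s)
    then show ?case using gens[OF \<open>s \<in> cayley_gens G\<close>] x[of "pres.proj a"] elt[of "pres.proj a"]
      by (auto simp: sym_x_closed sym_elt_closed)
  next
    case (gen_inv a s)
    then show ?case
      using gens[OF \<open>s \<in> cayley_gens G\<close>] x_inv[of "pres.proj a"] elt[of "pres.proj a" "inv g" for g]
      by (auto simp: sym_x_closed sym_elt_closed inv_elt)
  qed
  then show ?thesis by (simp add: a)
qed

lemma pres_normal_form: "p \<in> carrier pres.P \<Longrightarrow> p \<in> pc.normal_form"
proof (induction rule: pres_P_induct)
  case (x p)
  then show ?case using pc.normal_form_x[of p 1] by (simp add: sym_x_closed)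
next
  case (x_inv p)
  then show ?case using pc.normal_form_x[of p "-1"] by (simp add: sym_x_closed pres.P.int_pow_neg)
qed (auto intro: pc.normal_form_one pc.normal_form_t pc_rel)

text \<open>The table relations hold because \<open>first_mult\<close> is a homomorphism, the
  commutator relations by \<open>rel_all\<close>.\<close>

lemma pres_hom_exists:
  "\<exists>\<phi> \<in> hom pres.P Sym\<Omega>. \<phi> pres_x = quot_map
    \<and> (\<forall>g \<in> carrier G. \<phi> (pres_elt g) = first_mult g)"
proof -
  let ?f = "\<lambda>s. case s of Sym_x \<Rightarrow> quot_map | Sym_elt g \<Rightarrow> first_mult g"
  have "?f \<in> cayley_gens G \<rightarrow> carrier Sym\<Omega>"
    by (auto simp: cayley_gens_def quot_map_closed first_mult_closed)
  then obtain \<psi> where hom: "\<psi> \<in> hom (cayley_free G) Sym\<Omega>"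
    and gen: "\<And>s. s \<in> cayley_gens G \<Longrightarrow> \<psi> (free_gen (cayley_gens G) s) = ?f s"
    using free_group_universal[OF group_Sym] by blast
  interpret \<psi>: group_hom "cayley_free G" "Sym\<Omega>" \<psi> using hom by unfold_locales
  have x: "\<psi> (sym_x G) = quot_map" using gen[of Sym_x] by (simp add: sym_x_def cayley_gens_def)
  have elt: "\<psi> (sym_elt G g) = first_mult g" if "g \<in> carrier G" for g
  proof (cases "g = \<one>")
    case True
    then show ?thesis using \<psi>.hom_one act.t_one by (simp only: sym_elt_def simp_thms if_True)
  next
    case False
    then have "Sym_elt g \<in> cayley_gens G" using that by (simp add: cayley_gens_def)
    from gen[OF this] False show ?thesis by (simp add: sym_elt_def)
  qed
  have cj: "\<psi> (x_conj G i (sym_elt G g)) = act.cj i g" if "g \<in> carrier G" for i g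
    using that by (simp add: x_conj_def cpow_def \<psi>.hom_int_pow sym_x_closed sym_elt_closed x elt)
  have rel: "\<psi> l = \<psi> r" if "(l, r) \<in> cayley_relations G" for l r
    using that
  proof
    assume "(l, r) \<in> table_relations G"
    then show ?thesis using first_mult_hom
      by (auto simp: table_relations_def sym_elt_closed elt hom_mult)
  next
    assume "(l, r) \<in> commutator_relations G"
    then obtain m n g h where gh: "g \<in> carrier G" "h \<in> carrier G"
      and l: "l = commutator (cayley_free G) (x_conj G m (sym_elt G g)) (x_conj G n (sym_elt G h))"
      and r: "r = x_conj G ((m + n + 1) div 2) (sym_elt G (commutator G g h))"
      unfolding commutator_relations_def ceiling_half by (auto simp: add.commute)
    show ?thesis
      unfolding l r using gh act.relD[OF rel_all gh, of m n]
      by (simp add: \<psi>.commutator_hom x_conj_closed cj act.A.commutator_eq_iff)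
  qed
  obtain \<phi> where \<phi>: "\<phi> \<in> hom pres.P Sym\<Omega>" "\<And>a. a \<in> carrier pres.F \<Longrightarrow> \<phi> (pres.proj a) = \<psi> a"
    using pres.presented_universal[OF group_Sym hom rel] by blast
  show ?thesis using x elt by (intro bexI[OF _ \<phi>(1)]) (simp add: \<phi>(2) sym_x_closed sym_elt_closed)
qed

section \<open>Injectivity and image of the homomorphism\<close>

context
  fixes \<phi>
  assumes \<phi>_hom: "\<phi> \<in> hom pres.P Sym\<Omega>" and \<phi>_x: "\<phi> pres_x = quot_map"
    and \<phi>_elt: "\<And>g. g \<in> carrier G \<Longrightarrow> \<phi> (pres_elt g) = first_mult g"
begin

interpretation \<phi>: group_hom pres.P "Sym\<Omega>" \<phi>
  using \<phi>_hom by unfold_locales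

lemma \<phi>_op: "f \<in> UNIV \<rightarrow> carrier G \<Longrightarrow> \<phi> (pc.op n f) = act.op n f"
proof (induction n)
  case (Suc n)
  have fc: "f i \<in> carrier G" for i using Suc.prems by auto
  have "\<phi> (pc.cj (int n) (f n)) = act.cj (int n) (f n)"
    using fc by (simp add: cpow_def \<phi>.hom_int_pow \<phi>_x \<phi>_elt)
  then show ?case using Suc fc by simp
qed simp

lemma \<phi>_inj:
  assumes "g \<in> carrier G" "g \<noteq> \<one>"
  shows "inj_on \<phi> (carrier pres.P)"
proof (rule \<phi>.inj_on_one_iff[THEN iffD2], intro allI impI)
  fix p assume p: "p \<in> carrier pres.P" "\<phi> p = \<one>\<^bsub>Sym\<Omega>\<^esub>"
  then obtain d n f and j :: int where f: "f \<in> UNIV \<rightarrow> carrier G"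
    and pe: "p = pres_x [^]\<^bsub>pres.P\<^esub> (d::int) \<otimes>\<^bsub>pres.P\<^esub> pc.op n f \<otimes>\<^bsub>pres.P\<^esub> pres_x [^]\<^bsub>pres.P\<^esub> j"
    using pres_normal_form unfolding pc.normal_form_def by blast
  have o [simp]: "pc.op n f \<in> carrier pres.P" "act.op n f \<in> carrier Sym\<Omega>"
    using f by (auto intro!: pc.op_closed act.op_closed)
  let ?X = "\<lambda>i::int. quot_map [^]\<^bsub>Sym\<Omega>\<^esub> i"
  have "?X d \<bullet> act.op n f \<bullet> ?X j = \<one>\<^bsub>Sym\<Omega>\<^esub>"
    using p(2) f by (simp add: pe \<phi>.hom_int_pow \<phi>_x \<phi>_op)
  \<comment> \<open>Cancelling the outer powers leaves a product of conjugates equal to a power of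
    X. That power must be zero, then all letters are trivial, and the normal form collapses to x^d
    x^(-d).\<close>
  then have "?X (- d) \<bullet> (?X d \<bullet> act.op n f \<bullet> ?X j) \<bullet> ?X (- j) = ?X (- d) \<bullet> ?X (- j)" by simp
  moreover have "?X (- d) \<bullet> (?X d \<bullet> act.op n f \<bullet> ?X j) \<bullet> ?X (- j)
      = (?X (- d) \<bullet> ?X d) \<bullet> act.op n f \<bullet> (?X j \<bullet> ?X (- j))"
    by (simp only: act.A.m_assoc act.A.m_closed act.A.int_pow_closed quot_map_closed o)
  ultimately have e: "act.op n f = ?X (- d - j)"
    using act.A.int_pow_mult[OF quot_map_closed, of "- d" "- j"] by simp
  then have "- d - j = 0" by (rule op_eq_quot_pow[OF f assms])
  then have dj: "j = - d" and "act.op n f = \<one>\<^bsub>Sym\<Omega>\<^esub>" using e by auto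
  then have "pc.op n f = \<one>\<^bsub>pres.P\<^esub>" using op_eq_one[OF f] by (intro pc.op_one)
  then show "p = \<one>\<^bsub>pres.P\<^esub>" by (simp add: pe dj sym_x_closed)
qed

text \<open>X is the inverse of state 1, \<open>first_mult g\<close> is X times state g, and
  conversely state g is inv X times \<open>first_mult g\<close>; so both generating sets give the
  same subgroup.\<close>

lemma \<phi>_image:
  "\<phi> ` carrier pres.P = generate Sym\<Omega> (state_map (cayley_machine G) ` carrier G)"
proof
  let ?R = "state_map (cayley_machine G) ` carrier G"
  have R: "?R \<subseteq> carrier Sym\<Omega>" by (auto intro: state_map_closed)
  have U: "state_map (cayley_machine G) \<one> \<in> generate Sym\<Omega> ?R"
    "quot_map \<in> generate Sym\<Omega> ?R"
    unfolding quot_map_def by (auto intro: generate.incl generate.inv)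
  have T: "first_mult g \<in> generate Sym\<Omega> ?R" if "g \<in> carrier G" for g
    unfolding state_map_conv_first_mult[OF that, symmetric]
    using U that by (auto intro: generate.incl generate.eng)
  have "\<phi> p \<in> generate Sym\<Omega> ?R" if "p \<in> carrier pres.P" for p
    using that
  proof (induction rule: pres_P_induct)
    case one
    then show ?case by (simp add: generate.one)
  next
    case (x p)
    then show ?case using U by (simp add: \<phi>_x generate.eng sym_x_closed)
  next
    case (x_inv p)
    have "inv\<^bsub>Sym\<Omega>\<^esub> quot_map = state_map (cayley_machine G) \<one>"
      by (simp add: quot_map_def state_map_closed)
    then show ?case using x_inv U by (simp add: \<phi>_x generate.eng sym_x_closed)
  next
    case (elt p g)
    then show ?case using T by (simp add: \<phi>_elt generate.eng sym_elt_closed)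
  qed
  then show "\<phi> ` carrier pres.P \<subseteq> generate Sym\<Omega> ?R" by blast
  have "?R \<subseteq> \<phi> ` carrier pres.P"
  proof
    fix u assume "u \<in> ?R"
    then obtain g where g: "g \<in> carrier G" "u = state_map (cayley_machine G) g" by blast
    have "u = inv\<^bsub>Sym\<Omega>\<^esub> quot_map \<bullet> first_mult g"
      using g state_map_conv_first_mult[OF g(1)]
      by (metis act.A.inv_solve_left act.t_closed act.x_closed state_map_closed)
    also have "\<dots> = \<phi> (inv\<^bsub>pres.P\<^esub> pres_x \<otimes>\<^bsub>pres.P\<^esub> pres_elt g)"
      using g by (simp add: \<phi>_x \<phi>_elt sym_x_closed sym_elt_closed)
    finally show "u \<in> \<phi> ` carrier pres.P"
    proof (rule image_eqI)
      show "inv\<^bsub>pres.P\<^esub> pres_x \<otimes>\<^bsub>pres.P\<^esub> pres_elt g \<in> carrier pres.P"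
        using g by (simp add: sym_x_closed sym_elt_closed)
    qed
  qed
  then show "generate Sym\<Omega> ?R \<subseteq> \<phi> ` carrier pres.P"
    by (rule act.A.generate_subgroup_incl[OF _ \<phi>.img_is_subgroup])
qed

end

lemma automata_group_cayley:
  "automata_group (cayley_machine G)
    = Sym\<Omega>\<lparr>carrier := generate Sym\<Omega> (state_map (cayley_machine G) ` carrier G)\<rparr>"
  by (simp add: automata_group_def cayley_machine_def)

end

theorem theorem1p1:
  fixes G :: "('a, 'b) monoid_scheme"
  assumes "group G"
    and "finite (carrier G)"
    and "carrier G \<noteq> {\<one>\<^bsub>G\<^esub>}"
    and "step2_nilpotent G"
    and "\<And>g. g \<in> carrier G \<Longrightarrow> g [^]\<^bsub>G\<^esub> (2::nat) \<in> centre G"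
  shows "\<exists>\<phi> \<in> iso (presented_group (cayley_gens G) (cayley_relations G))
                  (automata_group (cayley_machine G)).
           \<phi> (presented_gen (cayley_gens G) (cayley_relations G) Sym_x)
             = inv\<^bsub>automata_group (cayley_machine G)\<^esub> (state_map (cayley_machine G) \<one>\<^bsub>G\<^esub>)
         \<and> (\<forall>g \<in> carrier G - {\<one>\<^bsub>G\<^esub>}.
             \<phi> (presented_gen (cayley_gens G) (cayley_relations G) (Sym_elt g))
               = inv\<^bsub>automata_group (cayley_machine G)\<^esub> (state_map (cayley_machine G) \<one>\<^bsub>G\<^esub>)
                   \<otimes>\<^bsub>automata_group (cayley_machine G)\<^esub> state_map (cayley_machine G) g)"
proof -
  interpret cayley_presentation G
    using assms(1,4,5)
    by (auto simp: cayley_presentation_def central_squares_group_def central_squares_group_axioms_def step2_nilpotent_def)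
  \<comment> \<open>Injectivity needs a non-trivial letter to tell the powers of X apart.\<close>
  obtain g where g: "g \<in> carrier G" "g \<noteq> \<one>\<^bsub>G\<^esub>" using assms(3) one_closed by blast
  obtain \<phi> where \<phi>: "\<phi> \<in> hom pres.P Sym\<Omega>" "\<phi> pres_x = quot_map"
    "\<And>g. g \<in> carrier G \<Longrightarrow> \<phi> (pres_elt g) = first_mult g"
    using pres_hom_exists by blast
  let ?A = "automata_group (cayley_machine G)"
  let ?H = "generate Sym\<Omega> (state_map (cayley_machine G) ` carrier G)"
  have H: "subgroup ?H Sym\<Omega>"
    by (rule act.A.generate_is_subgroup) (auto intro: state_map_closed)
  have im: "\<phi> ` carrier pres.P = ?H" by (rule \<phi>_image[OF \<phi>])
  have "\<phi> \<in> hom pres.P ?A"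
    using \<phi>(1) im by (auto simp: hom_def automata_group_cayley)
  moreover have "bij_betw \<phi> (carrier pres.P) (carrier ?A)"
    using \<phi>_inj[OF \<phi> g] im by (simp add: bij_betw_def automata_group_cayley)
  ultimately have "\<phi> \<in> iso pres.P ?A" by (simp add: iso_def)
  \<comment> \<open>Inverses in the subgroup agree with those among all bijections.\<close>
  moreover have "inv\<^bsub>?A\<^esub> (state_map (cayley_machine G) \<one>\<^bsub>G\<^esub>) = quot_map"
    unfolding automata_group_cayley quot_map_def
    by (rule act.A.m_inv_consistent[OF H]) (auto intro: generate.incl)
  moreover have "presented_gen (cayley_gens G) (cayley_relations G) Sym_x = pres_x"
    by (simp add: presented_gen_def pres.proj_def sym_x_def)
  moreover have "presented_gen (cayley_gens G) (cayley_relations G) (Sym_elt h) = pres_elt h"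
    if "h \<noteq> \<one>\<^bsub>G\<^esub>" for h
    using that by (simp add: presented_gen_def pres.proj_def sym_elt_def)
  ultimately show ?thesis
    using \<phi>(2,3) state_map_conv_first_mult by (intro bexI[of _ \<phi>]) (auto simp: automata_group_cayley)
qed

end
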